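(* Let $T\ge2$ and let $\mathcal I=(0,1)^{2(T-1)}$ with points written $(\mathbf a,\mathbf b)=(a_1,\dots,a_{T-1},b_1,\dots,b_{T-1})$. Define $\vartheta:\mathcal I\to\mathbb G(1,\mathbb C^T)$ by $$\vartheta(\mathbf a,\mathbf b)=\left[\begin{matrix}\sqrt{1-\|\mathbf w\|^2}\\ \mathbf w\end{matrix}\right],\qquad \mathbf w=\mathbf z\,f_{T-1}(\|\mathbf z\|),\qquad \mathbf z=(z_1,\dots,z_{T-1})^{\mathrm T},\ z_k=F^{-1}(a_k)+jF^{-1}(b_k),$$ where $F(t)=\frac1{\sqrt\pi}\int_{-\infty}^t e^{-s^2}ds$ and $f_{T-1}(t)=\frac1t\left(1-e^{-t^2}\sum_{k=0}^{T-2}\frac{t^{2k}}{k!}\right)^{1/(2(T-1))}$. Then $\vartheta$ is measure preserving: if $(\mathbf a,\mathbf b)$ is uniformly distributed in $\mathcal I$, then $\vartheta(\mathbf a,\mathbf b)$ is uniformly distributed in $\mathbb G(1,\mathbb C^T)$; equivalently, for every integrable $G:\mathbb G(1,\mathbb C^T)\to\mathbb C$, $$\frac1{\operatorname{Vol}(\mathbb G(1,\mathbb C^T))}\int_{\mathbb G(1,\mathbb C^T)}G([\mathbf x])\,d[\mathbf x]=\int_{\mathcal I}G(\vartheta(\mathbf a,\mathbf b))\,d(\mathbf a,\mathbf b).$$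
   Context: $j$ is the imaginary unit. $F$ is the cumulative distribution function of $\mathcal N(0,1/2)$. $\mathbb G(1,\mathbb C^T)$ is the complex projective space of lines in $\mathbb C^T$, $[\mathbf x]$ the line spanned by a nonzero $\mathbf x$, and $d[\mathbf x]$ its $U(T)$-invariant (Riemannian) volume measure; "uniformly distributed" means distributed according to the normalized invariant measure. $\|\cdot\|$ is the Euclidean norm; the value of $\mathbf z f_{T-1}(\|\mathbf z\|)$ at $\mathbf z=0$ is taken to be $0$. *)

theory Defs
  imports "HOL-Probability.Probability"
begin

text \<open>Vectors of \<open>\<complex>^T\<close> are functions \<open>nat \<Rightarrow> complex\<close> in \<open>PiE {..<T} (\<lambda>_. UNIV)\<close>
  (coordinates indexed 0..T-1, value undefined outside).\<close>

definition cvecM :: "nat \<Rightarrow> (nat \<Rightarrow> complex) measure" where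
  "cvecM T = PiM {..<T} (\<lambda>_. borel)"

definition nonzero_vec :: "nat \<Rightarrow> (nat \<Rightarrow> complex) \<Rightarrow> bool" where
  "nonzero_vec T x \<longleftrightarrow> (\<exists>i<T. x i \<noteq> 0)"

text \<open>The complex line \<open>[x]\<close> spanned by \<open>x\<close>, represented as the set of its nonzero points.\<close>
definition line :: "nat \<Rightarrow> (nat \<Rightarrow> complex) \<Rightarrow> (nat \<Rightarrow> complex) set" where
  "line T x = {restrict (\<lambda>i. c * x i) {..<T} | c. c \<noteq> 0}"

definition lines :: "nat \<Rightarrow> (nat \<Rightarrow> complex) set set" where
  "lines T = line T ` {x \<in> space (cvecM T). nonzero_vec T x}"

text \<open>Borel structure on \<open>G(1,\<complex>^T)\<close>: the quotient (final) sigma algebra of \<open>x \<mapsto> [x]\<close>.\<close>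
definition lines_measure :: "nat \<Rightarrow> (nat \<Rightarrow> complex) set measure" where
  "lines_measure T = measure_of (lines T)
     {S. S \<subseteq> lines T \<and>
         {x \<in> space (cvecM T). nonzero_vec T x \<and> line T x \<in> S} \<in> sets (cvecM T)}
     (\<lambda>_. 0)"

definition unitary :: "nat \<Rightarrow> (nat \<Rightarrow> nat \<Rightarrow> complex) \<Rightarrow> bool" where
  "unitary T U \<longleftrightarrow>
     (\<forall>k<T. \<forall>l<T. (\<Sum>i<T. cnj (U i k) * U i l) = (if k = l then 1 else 0))"

definition mat_apply :: "nat \<Rightarrow> (nat \<Rightarrow> nat \<Rightarrow> complex) \<Rightarrow> (nat \<Rightarrow> complex) \<Rightarrow> (nat \<Rightarrow> complex)" where
  "mat_apply T U x = restrict (\<lambda>i. \<Sum>k<T. U i k * x k) {..<T}"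

definition line_act :: "nat \<Rightarrow> (nat \<Rightarrow> nat \<Rightarrow> complex) \<Rightarrow> (nat \<Rightarrow> complex) set \<Rightarrow> (nat \<Rightarrow> complex) set" where
  "line_act T U L = mat_apply T U ` L"

text \<open>The uniform distribution on \<open>G(1,\<complex>^T)\<close>: the (unique) \<open>U(T)\<close>-invariant Borel
  probability measure, i.e. the normalized invariant measure.\<close>
definition uniform_lines :: "nat \<Rightarrow> (nat \<Rightarrow> complex) set measure" where
  "uniform_lines T = (THE \<mu>. sets \<mu> = sets (lines_measure T) \<and> prob_space \<mu> \<and>
      (\<forall>U. unitary T U \<longrightarrow> line_act T U \<in> measurable \<mu> \<mu> \<and> distr \<mu> \<mu> (line_act T U) = \<mu>))"

text \<open>CDF of \<open>N(0,1/2)\<close> and its inverse on \<open>(0,1)\<close>.\<close>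
definition Fcdf :: "real \<Rightarrow> real" where
  "Fcdf t = (1 / sqrt pi) * (LBINT s:{..t}. exp (- (s\<^sup>2)))"

definition Finv :: "real \<Rightarrow> real" where
  "Finv a = (THE t. Fcdf t = a)"

definition fT :: "nat \<Rightarrow> real \<Rightarrow> real" where
  "fT n t = (1 / t) * (1 - exp (- (t\<^sup>2)) * (\<Sum>k<n. t ^ (2 * k) / fact k)) powr (1 / (2 * real n))"

text \<open>Points of \<open>I = (0,1)^{2(T-1)}\<close> are \<open>p\<close> with \<open>a_k = p k\<close>, \<open>b_k = p (T-1+k)\<close>, \<open>k < T-1\<close>.\<close>
definition zvec :: "nat \<Rightarrow> (nat \<Rightarrow> real) \<Rightarrow> nat \<Rightarrow> complex" where
  "zvec T p k = Complex (Finv (p k)) (Finv (p (T - 1 + k)))"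

definition cnorm :: "nat \<Rightarrow> (nat \<Rightarrow> complex) \<Rightarrow> real" where
  "cnorm n z = sqrt (\<Sum>k<n. (cmod (z k))\<^sup>2)"

definition wvec :: "nat \<Rightarrow> (nat \<Rightarrow> real) \<Rightarrow> nat \<Rightarrow> complex" where
  "wvec T p k = (if cnorm (T - 1) (zvec T p) = 0 then 0
                 else zvec T p k * complex_of_real (fT (T - 1) (cnorm (T - 1) (zvec T p))))"

definition theta :: "nat \<Rightarrow> (nat \<Rightarrow> real) \<Rightarrow> (nat \<Rightarrow> complex) set" where
  "theta T p = line T (restrict (\<lambda>i. if i = 0
        then complex_of_real (sqrt (1 - (cnorm (T - 1) (wvec T p))\<^sup>2))
        else wvec T p (i - 1)) {..<T})"

definition cubeM :: "nat \<Rightarrow> (nat \<Rightarrow> real) measure" where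
  "cubeM T = PiM {..<2 * (T - 1)} (\<lambda>_. uniform_measure lborel {0<..<1})"

end

theory Submission
  imports Defs
begin

text \<open>Put \<open>n = T - 1\<close> and let \<open>(x, z)\<close> be a standard Gaussian vector in \<open>\<complex> \<times> \<complex>\<^sup>n\<close>. Its line is invariant in law
  under unitary maps, and up to a phase, which the law of \<open>z\<close> absorbs, it is determined by the direction
  \<open>z / |z|\<close> and the ratio \<open>\<rho> = (|z|\<^sup>2 / (|z|\<^sup>2 + |x|\<^sup>2))\<^sup>n\<close>. On the other hand \<open>\<vartheta>\<close> is the same function of
  \<open>z / |z|\<close> and \<open>P(|z|\<^sup>2)\<close>, where \<open>P\<close> is the distribution function of \<open>|z|\<^sup>2\<close>. Scaling of Lebesgue measure shows
  that both \<open>\<rho>\<close> and \<open>P(|z|\<^sup>2)\<close> are uniform on \<open>(0,1)\<close> and independent of \<open>z / |z|\<close>, so the two laws on lines agree.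

  Two invariant probability measures \<open>\<mu>\<close>, \<open>\<nu>\<close> give all balls of a given radius \<open>\<epsilon>\<close> the same mass \<open>h(\<epsilon>) > 0\<close> (Fubini);
  averaging \<open>\<nu>(G \<inter> B(L, \<epsilon>)) / h(\<epsilon>)\<close> over an open set \<open>G\<close> with respect to \<open>\<mu>\<close> and letting \<open>\<epsilon> \<rightarrow> 0\<close> yields
  \<open>\<mu>(G) \<le> \<nu>(G)\<close>, hence \<open>\<mu> = \<nu>\<close>.\<close>

section \<open>Lebesgue and Gaussian measure on complex coordinate space\<close>

text \<open>\<open>uniform_lines\<close> is a definite description, so nothing can be read off from
  it until invariant probability measures are known to be unique; existence is supplied by the
  Gaussian vector. The obstacle to uniqueness is that the lines carry only a quotient sigma algebra,
  with neither a metric nor a convenient generator. Passing to projection matrices supplies both: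
  unitary maps preserve the distance of the matrices, and a suitable column of the matrix gives the
  line back measurably, so that measures on lines can be compared on open sets of matrices. The root
  in \<open>fT\<close> has its origin in the two uniform variables: the squared norm of
  \<open>w\<close> has to have the law of \<open>|z|^2 / (|z|^2 + |x|^2)\<close>, whose
  \<open>n\<close>-th power is uniform, whereas \<open>P(|z|^2)\<close> is uniform itself; hence
  \<open>|w|^2\<close> must be the \<open>n\<close>-th root of \<open>P(|z|^2)\<close>, and
  \<open>|w|\<close> the \<open>2 n\<close>-th root. The law of the direction is the same on both
  sides and is never computed.\<close>

abbreviation leb :: "nat \<Rightarrow> (nat \<Rightarrow> complex) measure" where
  "leb n \<equiv> PiM {..<n} (\<lambda>_. lborel)"

definition sqn :: "nat \<Rightarrow> (nat \<Rightarrow> complex) \<Rightarrow> real" where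
  "sqn n z = (\<Sum>i<n. (cmod (z i))\<^sup>2)"

interpretation lebp: product_sigma_finite "\<lambda>_::nat. lborel :: complex measure" ..

lemma sigma_finite_leb: "sigma_finite_measure (leb n)"
  by (rule lebp.sigma_finite) simp

lemma sqn_nonneg [simp]: "0 \<le> sqn n z"
  by (simp add: sqn_def sum_nonneg)

lemma sqn_restrict [simp]: "sqn n (restrict f {..<n}) = sqn n f"
  by (simp add: sqn_def)

lemma component_measurable [measurable]:
  "i < n \<Longrightarrow> (\<lambda>z. z i) \<in> borel_measurable (leb n)"
  using measurable_component_singleton[of i "{..<n}" "\<lambda>_. lborel :: complex measure"]
  by simp

lemma sqn_measurable [measurable]: "sqn n \<in> borel_measurable (leb n)"
  unfolding sqn_def by measurable

lemma leb_restrict_measurable: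
  assumes "\<And>i. i < n \<Longrightarrow> f i \<in> borel_measurable M"
  shows "(\<lambda>x. \<lambda>i\<in>{..<n}. f i x) \<in> measurable M (leb n)"
  using assms by (intro measurable_restrict) simp

lemma sets_leb: "sets (leb n) = sets (cvecM n)"
  unfolding cvecM_def by (intro sets_PiM_cong) auto

lemma space_leb: "space (leb n) = extensional {..<n}"
  by (simp add: space_PiM PiE_def)

text \<open>A product measure is determined by its values on boxes, and every coordinate contributes
  one factor \<open>k\<close>. Translations are the case \<open>k = 1\<close>; scaling by
  \<open>c\<close> is the case \<open>k = c^2\<close>, because \<complex> has real dimension
  2.\<close>

lemma leb_transform:
  fixes \<tau> :: "nat \<Rightarrow> complex \<Rightarrow> complex" and k :: ennreal
  assumes [measurable]: "\<And>i. i < n \<Longrightarrow> \<tau> i \<in> borel_measurable borel"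
    and k: "\<And>i A. i < n \<Longrightarrow> A \<in> sets borel \<Longrightarrow> k * emeasure lborel (\<tau> i -` A) = emeasure lborel A"
    and [measurable]: "f \<in> borel_measurable (leb n)"
  shows "k ^ n * (\<integral>\<^sup>+x. f (\<lambda>i\<in>{..<n}. \<tau> i (x i)) \<partial>leb n) = (\<integral>\<^sup>+x. f x \<partial>leb n)"
proof -
  let ?t = "\<lambda>x. \<lambda>i\<in>{..<n}. \<tau> i (x i)"
  have t [measurable]: "?t \<in> measurable (leb n) (leb n)"
    by (rule leb_restrict_measurable) measurable
  have "scale_measure (k ^ n) (distr (leb n) (leb n) ?t) = leb n"
  proof (rule lebp.PiM_eqI)
    fix A :: "nat \<Rightarrow> complex set" assume "\<And>i. i \<in> {..<n} \<Longrightarrow> A i \<in> sets lborel"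
    then have A: "\<And>i. i < n \<Longrightarrow> A i \<in> sets borel" by simp
    have V: "\<tau> i -` A i \<in> sets borel" if "i < n" for i
      using measurable_sets[OF assms(1)[OF that] A[OF that]] by simp
    have "emeasure (distr (leb n) (leb n) ?t) (Pi\<^sub>E {..<n} A)
        = emeasure (leb n) (?t -` Pi\<^sub>E {..<n} A \<inter> space (leb n))"
      using A by (intro emeasure_distr t sets_PiM_I_finite) auto
    also have "?t -` Pi\<^sub>E {..<n} A \<inter> space (leb n) = Pi\<^sub>E {..<n} (\<lambda>i. \<tau> i -` A i)"
      by (auto simp: space_leb PiE_def Pi_def)
    also have "emeasure (leb n) \<dots> = (\<Prod>i<n. emeasure lborel (\<tau> i -` A i))"
      using V by (intro lebp.emeasure_PiM) auto
    finally have "emeasure (scale_measure (k ^ n) (distr (leb n) (leb n) ?t)) (Pi\<^sub>E {..<n} A)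
       = (\<Prod>i<n. k * emeasure lborel (\<tau> i -` A i))"
      by (simp only: emeasure_scale_measure prod.distrib prod_constant card_lessThan)
    then show "emeasure (scale_measure (k ^ n) (distr (leb n) (leb n) ?t)) (Pi\<^sub>E {..<n} A)
       = (\<Prod>i<n. emeasure lborel (A i))"
      using k A by simp
  qed auto
  then have "(\<integral>\<^sup>+x. f x \<partial>leb n) = (\<integral>\<^sup>+x. f x \<partial>scale_measure (k ^ n) (distr (leb n) (leb n) ?t))"
    by simp
  also have "\<dots> = k ^ n * (\<integral>\<^sup>+x. f (?t x) \<partial>leb n)"
    by (subst nn_integral_scale_measure) (simp_all add: nn_integral_distr)
  finally show ?thesis by simp
qed

lemma leb_translate:
  assumes "f \<in> borel_measurable (leb n)"
  shows "(\<integral>\<^sup>+x. f (\<lambda>i\<in>{..<n}. x i + a i) \<partial>leb n) = (\<integral>\<^sup>+x. f x \<partial>leb n)"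
proof -
  have "1 * emeasure lborel ((\<lambda>x. x + c) -` A) = emeasure lborel A" if "A \<in> sets borel" for A and c :: complex
    using arg_cong[OF lborel_distr_plus[of c], of "\<lambda>M. emeasure M A"] that
    by (subst (asm) emeasure_distr) (auto simp: add.commute[of c] vimage_def)
  from leb_transform[of n "\<lambda>i x. x + a i" 1 f, OF _ this assms] show ?thesis by simp
qed

lemma leb_scale:
  assumes "f \<in> borel_measurable (leb n)" "c > 0"
  shows "(\<integral>\<^sup>+x. f x \<partial>leb n) = ennreal (c ^ (2 * n)) * (\<integral>\<^sup>+x. f (\<lambda>i\<in>{..<n}. complex_of_real c * x i) \<partial>leb n)"
proof -
  have "ennreal (c\<^sup>2) * emeasure lborel ((\<lambda>x. complex_of_real c * x) -` A) = emeasure lborel A" if A: "A \<in> sets borel" for A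
  proof -
    have "emeasure lborel A = emeasure (density (distr lborel borel (\<lambda>x. 0 + c *\<^sub>R x)) (\<lambda>_. \<bar>c\<bar>^DIM(complex))) A"
      using lborel_affine[of c "0::complex"] assms by simp
    also have "\<dots> = ennreal (c\<^sup>2) * emeasure (distr lborel borel (\<lambda>x. 0 + c *\<^sub>R x)) A"
      using A assms by (subst emeasure_density_const) auto
    also have "\<dots> = ennreal (c\<^sup>2) * emeasure lborel ((\<lambda>x. complex_of_real c * x) -` A)"
      using A by (subst emeasure_distr) (auto simp: scaleR_conv_of_real)
    finally show ?thesis by simp
  qed
  from leb_transform[of n "\<lambda>i x. complex_of_real c * x" "ennreal (c\<^sup>2)" f, OF _ this assms(1)]
  show ?thesis using assms by (simp add: ennreal_power power_mult)
qed


section \<open>Unitary matrices\<close>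

text \<open>\<open>unitary\<close> only says \<open>U* U = 1\<close>. The matrix
  \<open>P = U U*\<close> is Hermitian and idempotent, so the squared Frobenius norm of
  \<open>1 - P\<close> equals its trace, which is \<open>T\<close> minus the trace of
  \<open>U* U\<close>, hence 0.\<close>

lemma unitary_adjoint_right:
  assumes "unitary T U" "i < T" "l < T"
  shows "(\<Sum>k<T. U i k * cnj (U l k)) = (if i = l then 1 else 0)"
proof -
  define P where "P i j = (\<Sum>k<T. U i k * cnj (U j k))" for i j
  define d :: "nat \<Rightarrow> nat \<Rightarrow> complex" where "d i j = (if i = j then 1 else 0)" for i j
  have U: "(\<Sum>i<T. cnj (U i k) * U i m) = d k m" if "k < T" "m < T" for k m
    using assms(1) that by (auto simp: unitary_def d_def)
  have cnjP: "cnj (P i j) = P j i" for i j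
    by (simp add: P_def mult.commute)
  have idem: "(\<Sum>j<T. P i j * P j l) = P i l" for i l
  proof -
    have "(\<Sum>j<T. P i j * P j l) = (\<Sum>j<T. \<Sum>k<T. \<Sum>m<T. U i k * cnj (U l m) * (cnj (U j k) * U j m))"
      unfolding P_def sum_product by (intro sum.cong refl) (simp add: mult_ac)
    also have "\<dots> = (\<Sum>k<T. \<Sum>j<T. \<Sum>m<T. U i k * cnj (U l m) * (cnj (U j k) * U j m))"
      by (rule sum.swap)
    also have "\<dots> = (\<Sum>k<T. \<Sum>m<T. \<Sum>j<T. U i k * cnj (U l m) * (cnj (U j k) * U j m))"
      by (intro sum.cong refl sum.swap)
    also have "\<dots> = (\<Sum>k<T. \<Sum>m<T. U i k * cnj (U l m) * d k m)"
      using U by (intro sum.cong refl) (simp flip: sum_distrib_left)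
    also have "\<dots> = P i l"
      by (simp add: d_def P_def if_distrib cong: if_cong)
    finally show ?thesis .
  qed
  have trace: "(\<Sum>i<T. P i i) = of_nat T"
  proof -
    have "(\<Sum>i<T. P i i) = (\<Sum>k<T. \<Sum>i<T. cnj (U i k) * U i k)"
      unfolding P_def by (subst sum.swap) (simp add: mult.commute)
    also have "\<dots> = of_nat T" using U by (simp add: d_def)
    finally show ?thesis .
  qed
  have "complex_of_real (\<Sum>i<T. \<Sum>j<T. (cmod (d i j - P i j))\<^sup>2)
      = (\<Sum>i<T. \<Sum>j<T. (d i j - P i j) * cnj (d i j - P i j))"
    unfolding of_real_sum by (intro sum.cong refl) (simp only: complex_norm_square)
  also have "\<dots> = (\<Sum>i<T. \<Sum>j<T. d i j - d i j * P j i - d i j * P i j + P i j * P j i)"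
  proof (intro sum.cong refl)
    fix i j
    have "cnj (d i j - P i j) = d i j - P j i" by (simp add: cnjP d_def)
    then show "(d i j - P i j) * cnj (d i j - P i j) = d i j - d i j * P j i - d i j * P i j + P i j * P j i"
      by (simp only:) (simp add: d_def algebra_simps)
  qed
  also have "\<dots> = (\<Sum>i<T. 1 - P i i)"
  proof (intro sum.cong refl)
    fix i assume "i \<in> {..<T}"
    then have "(\<Sum>j<T. d i j) = 1" "(\<Sum>j<T. d i j * P j i) = P i i" "(\<Sum>j<T. d i j * P i j) = P i i"
      by (simp_all add: d_def if_distrib if_distribR cong: if_cong)
    then show "(\<Sum>j<T. d i j - d i j * P j i - d i j * P i j + P i j * P j i) = 1 - P i i"
      by (simp add: sum.distrib sum_subtractf idem)
  qed
  also have "\<dots> = 0" by (simp add: sum_subtractf trace)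
  finally have "(\<Sum>i<T. \<Sum>j<T. (cmod (d i j - P i j))\<^sup>2) = 0"
    using of_real_eq_0_iff by blast
  then have "cmod (d i l - P i l) = 0"
    using assms(2,3) by (simp add: sum_nonneg_eq_0_iff sum_nonneg)
  then show ?thesis by (simp add: P_def d_def)
qed

definition cinner :: "nat \<Rightarrow> (nat \<Rightarrow> complex) \<Rightarrow> (nat \<Rightarrow> complex) \<Rightarrow> complex" where
  "cinner T x y = (\<Sum>i<T. cnj (x i) * y i)"

lemma cinner_self: "cinner T x x = complex_of_real (sqn T x)"
  by (simp add: cinner_def sqn_def complex_norm_square mult.commute del: of_real_power)

lemma cinner_mat_apply:
  assumes "unitary T U"
  shows "cinner T (mat_apply T U x) (mat_apply T U y) = cinner T x y"
proof -
  have "cinner T (mat_apply T U x) (mat_apply T U y)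
      = (\<Sum>i<T. \<Sum>k<T. \<Sum>l<T. cnj (x k) * y l * (cnj (U i k) * U i l))"
    unfolding cinner_def mat_apply_def
    by (intro sum.cong refl, simp, subst sum_product, simp add: mult_ac)
  also have "\<dots> = (\<Sum>k<T. \<Sum>i<T. \<Sum>l<T. cnj (x k) * y l * (cnj (U i k) * U i l))"
    by (rule sum.swap)
  also have "\<dots> = (\<Sum>k<T. \<Sum>l<T. \<Sum>i<T. cnj (x k) * y l * (cnj (U i k) * U i l))"
    by (intro sum.cong refl sum.swap)
  also have "\<dots> = (\<Sum>k<T. \<Sum>l<T. cnj (x k) * y l * (if k = l then 1 else 0))"
    using assms by (intro sum.cong refl) (simp add: unitary_def flip: sum_distrib_left)
  also have "\<dots> = cinner T x y"
    by (simp add: cinner_def if_distrib cong: if_cong)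
  finally show ?thesis .
qed

lemma sqn_mat_apply:
  assumes "unitary T U"
  shows "sqn T (mat_apply T U x) = sqn T x"
  using cinner_mat_apply[OF assms, of x x] by (simp only: cinner_self of_real_eq_iff)

lemma mat_apply_adjoint:
  assumes "unitary T U"
  shows "mat_apply T U (mat_apply T (\<lambda>i k. cnj (U k i)) y) = restrict y {..<T}"
  unfolding mat_apply_def
proof (intro restrict_ext)
  fix i assume i: "i \<in> {..<T}"
  have "(\<Sum>k<T. U i k * (\<lambda>i\<in>{..<T}. \<Sum>k<T. cnj (U k i) * y k) k)
      = (\<Sum>k<T. \<Sum>l<T. y l * (U i k * cnj (U l k)))"
    by (intro sum.cong refl) (simp add: sum_distrib_left mult_ac)
  also have "\<dots> = (\<Sum>l<T. \<Sum>k<T. y l * (U i k * cnj (U l k)))"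
    by (rule sum.swap)
  also have "\<dots> = (\<Sum>l<T. y l * (if i = l then 1 else 0))"
    using i unitary_adjoint_right[OF assms] by (intro sum.cong refl) (simp flip: sum_distrib_left)
  also have "\<dots> = y i" using i by (simp add: if_distrib cong: if_cong)
  finally show "(\<Sum>k<T. U i k * (\<lambda>i\<in>{..<T}. \<Sum>k<T. cnj (U k i) * y k) k) = y i" .
qed

lemma mat_apply_linear:
  "mat_apply T U (\<lambda>i\<in>{..<T}. x i + y i) = (\<lambda>i\<in>{..<T}. mat_apply T U x i + mat_apply T U y i)"
  "mat_apply T U (\<lambda>i\<in>{..<T}. c * x i) = (\<lambda>i\<in>{..<T}. c * mat_apply T U x i)"
  unfolding mat_apply_def
  by (auto simp: algebra_simps sum.distrib sum_distrib_left intro!: restrict_ext)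

lemma mat_apply_measurable [measurable]: "mat_apply n U \<in> measurable (leb n) (leb n)"
  unfolding mat_apply_def by (rule leb_restrict_measurable) measurable


section \<open>Gaussian integrals over \<complex> and \<complex>^n\<close>

lemma lborel_complex_eq:
  "lborel = distr (lborel \<Otimes>\<^sub>M lborel) borel (\<lambda>(x, y). Complex x y)"
proof (rule lborel_eqI)
  fix l u :: complex assume le_Basis: "\<And>b. b \<in> Basis \<Longrightarrow> l \<bullet> b \<le> u \<bullet> b"
  have le: "Re l \<le> Re u" "Im l \<le> Im u"
    using le_Basis[of 1] le_Basis[of \<i>] by (auto simp: Basis_complex_def)
  have [measurable]: "(\<lambda>(x, y). Complex x y) \<in> borel_measurable (lborel \<Otimes>\<^sub>M lborel)"
    by (simp add: Complex_eq case_prod_beta)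
  have "(\<lambda>(x, y). Complex x y) -` box l u \<inter> space (lborel \<Otimes>\<^sub>M lborel) = {Re l<..<Re u} \<times> {Im l<..<Im u}"
    by (auto simp: box_def Basis_complex_def space_pair_measure)
  then show "emeasure (distr (lborel \<Otimes>\<^sub>M lborel) borel (\<lambda>(x, y). Complex x y)) (box l u)
      = ennreal (\<Prod>b\<in>Basis. (u - l) \<bullet> b)"
    using le by (simp add: emeasure_distr lborel.emeasure_pair_measure_Times Basis_complex_def
        ennreal_mult)
qed simp

lemma nn_integral_gauss_real: "(\<integral>\<^sup>+x. ennreal (exp (- x\<^sup>2)) \<partial>lborel) = ennreal (sqrt pi)"
proof -
  \<comment> \<open>Standard deviation \<open>1 / sqrt 2\<close> turns the exponent
    \<open>x^2 / (2 sigma^2)\<close> into \<open>x^2\<close>.\<close>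
  have eq: "exp (- x\<^sup>2) = sqrt pi * normal_density 0 (1 / sqrt 2) x" for x
    by (simp add: normal_density_def power_divide)
  have "(\<integral>\<^sup>+x. ennreal (normal_density 0 (1 / sqrt 2) x) \<partial>lborel) = 1"
    using prob_space.emeasure_space_1[OF prob_space_normal_density[of "1 / sqrt 2" 0]]
    by (simp add: emeasure_density)
  then show ?thesis
    unfolding eq by (simp add: ennreal_mult nn_integral_cmult)
qed

lemma nn_integral_gauss_complex:
  "(\<integral>\<^sup>+z. ennreal (exp (- (cmod z)\<^sup>2)) \<partial>lborel) = ennreal pi"
proof -
  have [measurable]: "(\<lambda>(x, y). Complex x y) \<in> borel_measurable (lborel \<Otimes>\<^sub>M lborel)"
    by (simp add: Complex_eq case_prod_beta)
  have "(\<integral>\<^sup>+z. ennreal (exp (- (cmod z)\<^sup>2)) \<partial>lborel)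
      = (\<integral>\<^sup>+x. \<integral>\<^sup>+y. ennreal (exp (- x\<^sup>2)) * ennreal (exp (- y\<^sup>2)) \<partial>lborel \<partial>lborel)"
    by (subst lborel_complex_eq, subst nn_integral_distr, simp, simp,
      subst lborel.nn_integral_fst[symmetric])
      (auto simp: cmod_power2 exp_add exp_minus ennreal_mult[symmetric] exp_diff divide_inverse)
  also have "\<dots> = ennreal (sqrt pi) * ennreal (sqrt pi)"
    by (simp add: nn_integral_cmult nn_integral_multc nn_integral_gauss_real)
  also have "\<dots> = ennreal pi" by (simp flip: ennreal_mult)
  finally show ?thesis .
qed

lemma exp_sqn: "ennreal (exp (- sqn n z)) = (\<Prod>i<n. ennreal (exp (- (cmod (z i))\<^sup>2)))"
  by (simp add: sqn_def sum_negf[symmetric] exp_sum prod_ennreal)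

lemma nn_integral_exp_sqn: "(\<integral>\<^sup>+z. ennreal (exp (- sqn n z)) \<partial>leb n) = ennreal (pi ^ n)"
  unfolding exp_sqn
  by (subst lebp.product_nn_integral_prod) (auto simp: nn_integral_gauss_complex ennreal_power)

text \<open>Lebesgue measure is compared with its image under \<open>U\<close> by evaluating
  \<open>\<integral>\<integral> f (U x + y) exp(-|y|\<^sup>2) dx dy\<close> in both orders: only translation invariance and
  \<open>|U x| = |x|\<close> are needed, no determinants.\<close>

lemma leb_unitary:
  assumes U: "unitary n U" and [measurable]: "f \<in> borel_measurable (leb n)"
  shows "(\<integral>\<^sup>+x. f (mat_apply n U x) \<partial>leb n) = (\<integral>\<^sup>+x. f x \<partial>leb n)"
proof -
  interpret sigma_finite_measure "leb n" by (rule sigma_finite_leb)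
  interpret P: pair_sigma_finite "leb n" "leb n" ..
  define g where "g z = ennreal (exp (- sqn n z))" for z
  define plus where "plus x y = (\<lambda>i\<in>{..<n}. x i + y i)" for x y :: "nat \<Rightarrow> complex"
  define V where "V = (\<lambda>i k. cnj (U k i))"
  let ?U = "mat_apply n U" and ?V = "mat_apply n V"
  have [measurable]: "g \<in> borel_measurable (leb n)"
    unfolding g_def by measurable
  have ps [measurable]: "(\<lambda>p. plus (h p) (k p)) \<in> measurable M (leb n)"
    if [measurable]: "h \<in> measurable M (leb n)" "k \<in> measurable M (leb n)"
    for h k and M :: "'a measure"
    unfolding plus_def by (rule leb_restrict_measurable) measurable
  have g: "g (?U x) = g x" for x by (simp add: g_def sqn_mat_apply[OF U])
  have g_neg: "g (\<lambda>i\<in>{..<n}. - x i) = g x" for x by (simp add: g_def sqn_def)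
  have UV: "?U (?V y) = restrict y {..<n}" for y
    unfolding V_def by (rule mat_apply_adjoint[OF U])
  have tr: "(\<integral>\<^sup>+x. h (plus x a) \<partial>leb n) = (\<integral>\<^sup>+x. h x \<partial>leb n)"
    if "h \<in> borel_measurable (leb n)" for h a
    unfolding plus_def by (rule leb_translate[OF that])
  have I: "(\<integral>\<^sup>+x. g x \<partial>leb n) = ennreal (pi ^ n)"
    unfolding g_def by (rule nn_integral_exp_sqn)
  have "(\<integral>\<^sup>+x. f (?U x) \<partial>leb n) * ennreal (pi ^ n)
      = (\<integral>\<^sup>+y. (\<integral>\<^sup>+x. f (?U x) \<partial>leb n) * g y \<partial>leb n)"
    by (simp add: nn_integral_cmult I)
  also have "\<dots> = (\<integral>\<^sup>+y. \<integral>\<^sup>+x. f (plus (?U x) y) * g y \<partial>leb n \<partial>leb n)"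
  proof (rule nn_integral_cong)
    \<comment> \<open>Since \<open>y = U (V y)\<close>, shifting \<open>x\<close> by
      \<open>V y\<close> adds \<open>y\<close> to \<open>U x\<close>.\<close>
    fix y assume "y \<in> space (leb n)"
    then have y: "restrict y {..<n} = y" by (simp add: space_leb extensional_restrict)
    have "(\<integral>\<^sup>+x. f (?U x) \<partial>leb n) = (\<integral>\<^sup>+x. f (?U (plus x (?V y))) \<partial>leb n)"
      by (rule tr[symmetric]) measurable
    also have "\<dots> = (\<integral>\<^sup>+x. f (plus (?U x) y) \<partial>leb n)"
      by (simp add: plus_def mat_apply_linear UV y cong: restrict_cong)
    finally show "(\<integral>\<^sup>+x. f (?U x) \<partial>leb n) * g y = (\<integral>\<^sup>+x. f (plus (?U x) y) * g y \<partial>leb n)"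
      using \<open>y \<in> space (leb n)\<close> by (simp add: nn_integral_multc)
  qed
  also have "\<dots> = (\<integral>\<^sup>+x. \<integral>\<^sup>+y. f (plus (?U x) y) * g y \<partial>leb n \<partial>leb n)"
    by (rule P.Fubini') measurable
  also have "\<dots> = (\<integral>\<^sup>+x. \<integral>\<^sup>+y. f y * g (\<lambda>i\<in>{..<n}. y i - ?U x i) \<partial>leb n \<partial>leb n)"
  proof (rule nn_integral_cong)
    \<comment> \<open>The shift of \<open>y\<close> by \<open>U x\<close> moves the dependence on
      \<open>U\<close> from \<open>f\<close> to the radial function \<open>g\<close>.\<close>
    fix x assume x: "x \<in> space (leb n)"
    have [measurable]: "(\<lambda>y. \<lambda>i\<in>{..<n}. y i - ?U x i) \<in> measurable (leb n) (leb n)"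
      by (rule leb_restrict_measurable) measurable
    have "(\<integral>\<^sup>+y. f y * g (\<lambda>i\<in>{..<n}. y i - ?U x i) \<partial>leb n)
       = (\<integral>\<^sup>+y. f (plus y (?U x)) * g (\<lambda>i\<in>{..<n}. plus y (?U x) i - ?U x i) \<partial>leb n)"
      by (rule tr[symmetric]) measurable
    also have "\<dots> = (\<integral>\<^sup>+y. f (plus (?U x) y) * g y \<partial>leb n)"
      by (simp add: plus_def g_def add.commute cong: restrict_cong)
    finally show "(\<integral>\<^sup>+y. f (plus (?U x) y) * g y \<partial>leb n)
      = (\<integral>\<^sup>+y. f y * g (\<lambda>i\<in>{..<n}. y i - ?U x i) \<partial>leb n)" by simp
  qed
  also have "\<dots> = (\<integral>\<^sup>+y. \<integral>\<^sup>+x. f y * g (\<lambda>i\<in>{..<n}. y i - ?U x i) \<partial>leb n \<partial>leb n)"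
  proof (rule P.Fubini')
    have "(\<lambda>p. \<lambda>i\<in>{..<n}. fst p i - ?U (snd p) i) \<in> measurable (leb n \<Otimes>\<^sub>M leb n) (leb n)"
      by (rule leb_restrict_measurable) measurable
    then show "(\<lambda>(y, x). f y * g (\<lambda>i\<in>{..<n}. y i - ?U x i)) \<in> borel_measurable (leb n \<Otimes>\<^sub>M leb n)"
      by (simp add: case_prod_beta)
  qed
  also have "\<dots> = (\<integral>\<^sup>+y. f y * ennreal (pi ^ n) \<partial>leb n)"
  proof (rule nn_integral_cong)
    fix y assume yM: "y \<in> space (leb n)"
    then have y: "restrict y {..<n} = y" by (simp add: space_leb extensional_restrict)
    have [measurable]: "(\<lambda>x. \<lambda>i\<in>{..<n}. y i - ?U x i) \<in> measurable (leb n) (leb n)"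
      by (rule leb_restrict_measurable) measurable
    \<comment> \<open>\<open>U\<close> maps \<open>x - V y\<close> to \<open>U x - y\<close>, and
      \<open>g\<close> is even and invariant under \<open>U\<close>; so the integrand is a translate
      of \<open>g\<close>, and its integral does not depend on \<open>y\<close>.\<close>
    define a where "a = (\<lambda>i\<in>{..<n}. - ?V y i)"
    have "g (\<lambda>i\<in>{..<n}. y i - ?U x i) = g (plus x a)" for x
    proof -
      have "plus x a = (\<lambda>i\<in>{..<n}. x i + (\<lambda>i\<in>{..<n}. (-1) * ?V y i) i)"
        by (auto simp: plus_def a_def)
      then have "?U (plus x a) = (\<lambda>i\<in>{..<n}. ?U x i - y i)"
        by (simp only: mat_apply_linear UV y) auto
      then have "g (plus x a) = g (\<lambda>i\<in>{..<n}. ?U x i - y i)"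
        using g[of "plus x a"] by simp
      then show ?thesis
        by (simp add: g_def sqn_def norm_minus_commute)
    qed
    then have "(\<integral>\<^sup>+x. g (\<lambda>i\<in>{..<n}. y i - ?U x i) \<partial>leb n) = ennreal (pi ^ n)"
      using tr[of g a] I by simp
    then show "(\<integral>\<^sup>+x. f y * g (\<lambda>i\<in>{..<n}. y i - ?U x i) \<partial>leb n) = f y * ennreal (pi ^ n)"
      by (simp add: nn_integral_cmult)
  qed
  also have "\<dots> = (\<integral>\<^sup>+y. f y \<partial>leb n) * ennreal (pi ^ n)"
    by (simp add: nn_integral_multc)
  finally show ?thesis
    using zero_less_power[OF pi_gt_zero, of n] by (auto simp: mult_right_ennreal_cancel)
qed


section \<open>The standard Gaussian measure\<close>

text \<open>With this normalization the real and imaginary parts of every coordinate have variance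
  1/2, matching \<open>Fcdf\<close>.\<close>

definition gauss :: "nat \<Rightarrow> (nat \<Rightarrow> complex) measure" where
  "gauss n = density (leb n) (\<lambda>z. ennreal (exp (- sqn n z) / pi ^ n))"

lemma sets_gauss [measurable_cong, simp]: "sets (gauss n) = sets (leb n)"
  by (simp add: gauss_def)

lemma space_gauss [simp]: "space (gauss n) = space (leb n)"
  by (simp add: gauss_def)

lemma ennreal_gauss_density:
  "ennreal (exp (- sqn n z) / pi ^ n) = ennreal (1 / pi ^ n) * ennreal (exp (- sqn n z))"
  by (simp flip: ennreal_mult)

lemma nn_integral_gauss:
  assumes [measurable]: "f \<in> borel_measurable (leb n)"
  shows "(\<integral>\<^sup>+z. f z \<partial>gauss n) = ennreal (1 / pi ^ n) * (\<integral>\<^sup>+z. ennreal (exp (- sqn n z)) * f z \<partial>leb n)"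
  unfolding gauss_def ennreal_gauss_density
  by (subst nn_integral_density) (simp_all add: mult.assoc nn_integral_cmult)

lemma prob_space_gauss: "prob_space (gauss n)"
proof
  have "(\<integral>\<^sup>+z. 1 \<partial>gauss n) = 1"
    by (subst nn_integral_gauss) (simp_all add: nn_integral_exp_sqn flip: ennreal_mult)
  then show "emeasure (gauss n) (space (gauss n)) = 1" by simp
qed

lemma gauss_unitary:
  assumes "unitary n U" and [measurable]: "f \<in> borel_measurable (leb n)"
  shows "(\<integral>\<^sup>+z. f (mat_apply n U z) \<partial>gauss n) = (\<integral>\<^sup>+z. f z \<partial>gauss n)"
proof -
  have "(\<integral>\<^sup>+z. ennreal (exp (- sqn n z)) * f (mat_apply n U z) \<partial>leb n)
      = (\<integral>\<^sup>+z. ennreal (exp (- sqn n (mat_apply n U z))) * f (mat_apply n U z) \<partial>leb n)"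
    by (simp add: sqn_mat_apply[OF assms(1)])
  also have "\<dots> = (\<integral>\<^sup>+z. ennreal (exp (- sqn n z)) * f z \<partial>leb n)"
    by (rule leb_unitary[OF assms(1)]) measurable
  finally show ?thesis
    by (simp add: nn_integral_gauss)
qed

lemma nn_integral_gauss_1:
  assumes [measurable]: "f \<in> borel_measurable borel"
  shows "(\<integral>\<^sup>+z. f (z 0) \<partial>gauss 1) = (\<integral>\<^sup>+z. ennreal (exp (- (cmod z)\<^sup>2) / pi) * f z \<partial>lborel)"
proof -
  have [measurable]: "(\<lambda>z. z 0) \<in> borel_measurable (PiM {0::nat} (\<lambda>_. lborel :: complex measure))"
    using measurable_component_singleton[of "0::nat" "{0}" "\<lambda>_. lborel :: complex measure"] by simp
  have "(\<integral>\<^sup>+z. f (z 0) \<partial>gauss 1)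
      = (\<integral>\<^sup>+z. ennreal (exp (- (cmod (z 0))\<^sup>2) / pi) * f (z 0) \<partial>PiM {0::nat} (\<lambda>_. lborel))"
    unfolding gauss_def by (subst nn_integral_density) (auto simp: lessThan_Suc sqn_def)
  also have "\<dots> = (\<integral>\<^sup>+z. ennreal (exp (- (cmod z)\<^sup>2) / pi) * f z \<partial>lborel)"
    by (rule lebp.product_nn_integral_singleton) simp
  finally show ?thesis .
qed

text \<open>The law of a single coordinate, on \<complex> itself instead of functions on
  \<open>{..<1}\<close>. It serves as the factor in \<open>PiM_gauss1\<close> and as the law of the
  first homogeneous coordinate.\<close>

definition gauss1 :: "complex measure" where
  "gauss1 = density lborel (\<lambda>z. ennreal (exp (- (cmod z)\<^sup>2) / pi))"

lemma sets_gauss1 [measurable_cong, simp]: "sets gauss1 = sets borel"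
  by (simp add: gauss1_def)

lemma space_gauss1 [simp]: "space gauss1 = UNIV"
  by (simp add: gauss1_def)

lemma nn_integral_gauss1:
  assumes [measurable]: "f \<in> borel_measurable borel"
  shows "(\<integral>\<^sup>+z. f z \<partial>gauss1) = (\<integral>\<^sup>+z. f (z 0) \<partial>gauss 1)"
  unfolding gauss1_def by (simp add: nn_integral_density nn_integral_gauss_1 del: One_nat_def)

lemma prob_space_gauss1: "prob_space gauss1"
proof
  have "(\<integral>\<^sup>+z. 1 \<partial>gauss1) = (\<integral>\<^sup>+z. 1 \<partial>gauss 1)"
    by (rule nn_integral_gauss1) simp
  then show "emeasure gauss1 (space gauss1) = 1"
    using prob_space.emeasure_space_1[OF prob_space_gauss[of 1]] by simp
qed

lemma PiM_gauss1: "PiM {..<n} (\<lambda>_. gauss1) = gauss n"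
proof -
  interpret g: prob_space gauss1 by (rule prob_space_gauss1)
  interpret gp: product_sigma_finite "\<lambda>_::nat. gauss1" ..
  show ?thesis
  proof (rule gp.PiM_eqI[symmetric])
    show "sets (gauss n) = sets (PiM {..<n} (\<lambda>_. gauss1))"
      by (simp cong: sets_PiM_cong)
    fix A :: "nat \<Rightarrow> complex set" assume "\<And>i. i \<in> {..<n} \<Longrightarrow> A i \<in> sets gauss1"
    then have A: "\<And>i. i < n \<Longrightarrow> A i \<in> sets borel" by simp
    then have [measurable]: "Pi\<^sub>E {..<n} A \<in> sets (leb n)"
      by (intro sets_PiM_I_finite) auto
    have "emeasure (gauss n) (Pi\<^sub>E {..<n} A)
        = (\<integral>\<^sup>+z. (\<Prod>i<n. ennreal (exp (- (cmod (z i))\<^sup>2) / pi) * indicator (A i) (z i)) \<partial>leb n)"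
      unfolding gauss_def
      by (subst emeasure_density, simp, simp, rule nn_integral_cong)
         (auto simp: prod.distrib prod_ennreal prod_dividef exp_sum sqn_def space_leb PiE_def Pi_def
            sum_negf[symmetric] indicator_def)
    also have "\<dots> = (\<Prod>i<n. emeasure gauss1 (A i))"
      using A by (subst lebp.product_nn_integral_prod) (auto simp: gauss1_def emeasure_density intro!: prod.cong)
    finally show "emeasure (gauss n) (Pi\<^sub>E {..<n} A) = (\<Prod>i<n. emeasure gauss1 (A i))" .
  qed simp
qed

section \<open>Polar decomposition of the Gaussian measure\<close>

text \<open>Cones stand for the events that depend on the direction of \<open>z\<close> alone; see
  \<open>cone_dir\<close>.\<close>

definition cone :: "nat \<Rightarrow> (nat \<Rightarrow> complex) set \<Rightarrow> bool" where
  "cone n A \<longleftrightarrow> A \<in> sets (leb n) \<and>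
     (\<forall>c z. c > 0 \<longrightarrow> z \<in> space (leb n) \<longrightarrow> ((\<lambda>i\<in>{..<n}. complex_of_real c * z i) \<in> A \<longleftrightarrow> z \<in> A))"

lemma sqn_scale: "sqn n (\<lambda>i. c * z i) = (cmod c)\<^sup>2 * sqn n z"
  by (simp add: sqn_def norm_mult power_mult_distrib sum_distrib_left)

lemma cone_ball:
  assumes "cone n A" "0 < r"
  shows "emeasure (leb n) {z \<in> A. sqn n z \<le> r} = ennreal (r ^ n) * emeasure (leb n) {z \<in> A. sqn n z \<le> 1}"
proof -
  have [measurable]: "A \<in> sets (leb n)" using assms by (simp add: cone_def)
  have s: "{z \<in> A. sqn n z \<le> a} = A \<inter> {z \<in> space (leb n). sqn n z \<le> a}" for a
    using sets.sets_into_space[of A "leb n"] by auto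
  have [measurable]: "{z \<in> A. sqn n z \<le> a} \<in> sets (leb n)" for a
    unfolding s by measurable
  have "emeasure (leb n) {z \<in> A. sqn n z \<le> r} = (\<integral>\<^sup>+z. indicator {z \<in> A. sqn n z \<le> r} z \<partial>leb n)"
    by simp
  \<comment> \<open>\<open>sqn\<close> is the squared norm, so the ball has radius
    \<open>sqrt r\<close>, in real dimension \<open>2 * n\<close>.\<close>
  also have "\<dots> = ennreal (sqrt r ^ (2 * n)) *
      (\<integral>\<^sup>+z. indicator {z \<in> A. sqn n z \<le> r} (\<lambda>i\<in>{..<n}. complex_of_real (sqrt r) * z i) \<partial>leb n)"
    using assms by (intro leb_scale) auto
  also have "sqrt r ^ (2 * n) = r ^ n" using assms by (simp add: power_mult)
  also have "(\<integral>\<^sup>+z. indicator {z \<in> A. sqn n z \<le> r} (\<lambda>i\<in>{..<n}. complex_of_real (sqrt r) * z i) \<partial>leb n)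
      = (\<integral>\<^sup>+z. indicator {z \<in> A. sqn n z \<le> 1} z \<partial>leb n)"
    using assms by (intro nn_integral_cong) (auto simp: indicator_def cone_def sqn_scale)
  finally show ?thesis by simp
qed

lemma exp_tail: "(\<integral>\<^sup>+t. ennreal (exp (- t)) * indicator {r..} t \<partial>lborel) = ennreal (exp (- r))"
proof -
  have "((\<lambda>t::real. - exp (- t)) \<longlongrightarrow> - 0) at_top"
    by (intro tendsto_minus filterlim_compose[OF exp_at_bot] filterlim_uminus_at_bot_at_top)
  then have "(\<integral>\<^sup>+t. ennreal (exp (- t)) * indicator {r..} t \<partial>lborel) = ennreal (0 - (- exp (- r)))"
    by (intro nn_integral_FTC_atLeast) (auto intro!: derivative_eq_intros)
  then show ?thesis by simp
qed

text \<open>Layer cake: writing \<open>exp (- |z|\<^sup>2)\<close> as the integral of \<open>exp (- t)\<close> over \<open>t \<ge> |z|\<^sup>2\<close> reduces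
  the Gaussian measure of a part of a cone to volumes of balls in the cone.\<close>

lemma gauss_cone_layer:
  fixes m :: "real \<Rightarrow> real"
  assumes A: "cone n A" and [measurable]: "S \<in> sets borel" "m \<in> borel_measurable borel"
    and m: "\<And>r t. 0 < t \<Longrightarrow> 0 \<le> r \<Longrightarrow> r \<le> t \<and> r \<in> S \<longleftrightarrow> r \<le> m t"
    and m_pos: "\<And>t. 0 < t \<Longrightarrow> 0 < m t"
  shows "emeasure (gauss n) {z \<in> A. sqn n z \<in> S}
    = ennreal (1 / pi ^ n) * emeasure (leb n) {z \<in> A. sqn n z \<le> 1} *
      (\<integral>\<^sup>+t. ennreal (m t ^ n * exp (- t)) * indicator {0..} t \<partial>lborel)"
proof -
  interpret sigma_finite_measure "leb n" by (rule sigma_finite_leb)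
  interpret P: pair_sigma_finite "leb n" "lborel :: real measure" ..
  have [measurable]: "A \<in> sets (leb n)" using A by (simp add: cone_def)
  have s: "{z \<in> A. sqn n z \<in> B} = A \<inter> {z \<in> space (leb n). sqn n z \<in> B}" for B
    using sets.sets_into_space[of A "leb n"] by auto
  have AS [measurable]: "{z \<in> A. sqn n z \<in> B} \<in> sets (leb n)" if [measurable]: "B \<in> sets borel" for B
    unfolding s by measurable
  let ?V = "emeasure (leb n) {z \<in> A. sqn n z \<le> 1}"
  have "emeasure (gauss n) {z \<in> A. sqn n z \<in> S} = (\<integral>\<^sup>+z. indicator {z \<in> A. sqn n z \<in> S} z \<partial>gauss n)"
    by simp
  also have "\<dots> = ennreal (1 / pi ^ n) *
      (\<integral>\<^sup>+z. ennreal (exp (- sqn n z)) * indicator {z \<in> A. sqn n z \<in> S} z \<partial>leb n)"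
    by (rule nn_integral_gauss) simp
  also have "(\<integral>\<^sup>+z. ennreal (exp (- sqn n z)) * indicator {z \<in> A. sqn n z \<in> S} z \<partial>leb n)
      = (\<integral>\<^sup>+z. \<integral>\<^sup>+t. ennreal (exp (- t)) * (if sqn n z \<le> t then 1 else 0) * indicator {z \<in> A. sqn n z \<in> S} z \<partial>lborel \<partial>leb n)"
  proof (rule nn_integral_cong)
    fix z
    have "ennreal (exp (- sqn n z)) = (\<integral>\<^sup>+t. ennreal (exp (- t)) * (if sqn n z \<le> t then 1 else 0) \<partial>lborel)"
      by (subst exp_tail[symmetric], intro nn_integral_cong) (simp add: indicator_def)
    then show "ennreal (exp (- sqn n z)) * indicator {z \<in> A. sqn n z \<in> S} z
      = (\<integral>\<^sup>+t. ennreal (exp (- t)) * (if sqn n z \<le> t then 1 else 0) * indicator {z \<in> A. sqn n z \<in> S} z \<partial>lborel)"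
      by (simp add: nn_integral_multc)
  qed
  also have "\<dots> = (\<integral>\<^sup>+t. \<integral>\<^sup>+z. ennreal (exp (- t)) * (if sqn n z \<le> t then 1 else 0) * indicator {z \<in> A. sqn n z \<in> S} z \<partial>leb n \<partial>lborel)"
    by (rule P.Fubini'[symmetric]) measurable
  also have "\<dots> = (\<integral>\<^sup>+t. ?V * (ennreal (m t ^ n * exp (- t)) * indicator {0..} t) \<partial>lborel)"
  proof (rule nn_integral_cong_AE)
    show "AE t in lborel. (\<integral>\<^sup>+z. ennreal (exp (- t)) * (if sqn n z \<le> t then 1 else 0) * indicator {z \<in> A. sqn n z \<in> S} z \<partial>leb n)
      = ?V * (ennreal (m t ^ n * exp (- t)) * indicator {0..} t)"
      \<comment> \<open>\<open>m t\<close> is controlled only for \<open>t > 0\<close>; the point 0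
        is a null set.\<close>
      using AE_lborel_singleton[of 0]
    proof eventually_elim
      case (elim t)
      show ?case
      proof (cases "t > 0")
        \<comment> \<open>The slice at height \<open>t\<close> is the ball
          \<open>sqn n z \<le> m t\<close> of the cone, whose volume is known from
          \<open>cone_ball\<close>.\<close>
        case True
        have "(\<integral>\<^sup>+z. ennreal (exp (- t)) * (if sqn n z \<le> t then 1 else 0) * indicator {z \<in> A. sqn n z \<in> S} z \<partial>leb n)
          = (\<integral>\<^sup>+z. ennreal (exp (- t)) * indicator {z \<in> A. sqn n z \<in> {..m t}} z \<partial>leb n)"
          by (intro nn_integral_cong) (simp add: indicator_def flip: m[OF True sqn_nonneg])
        also have "\<dots> = ennreal (exp (- t)) * emeasure (leb n) {z \<in> A. sqn n z \<le> m t}"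
          using AS[of "{..m t}"] by (subst nn_integral_cmult_indicator) auto
        also have "\<dots> = ?V * ennreal (m t ^ n * exp (- t))"
          using m_pos[OF True] by (subst cone_ball[OF A]) (auto simp: ennreal_mult mult_ac)
        finally show ?thesis using True by simp
      next
        case False
        with elim have "t < 0" by simp
        then have "\<not> sqn n z \<le> t" for z using sqn_nonneg[of n z] by linarith
        with \<open>t < 0\<close> show ?thesis by simp
      qed
    qed
  qed
  also have "\<dots> = ?V * (\<integral>\<^sup>+t. ennreal (m t ^ n * exp (- t)) * indicator {0..} t \<partial>lborel)"
    by (rule nn_integral_cmult) measurable
  finally show ?thesis by (simp add: mult.assoc)
qed

text \<open>For \<open>n > 0\<close> this is the regularized lower incomplete gamma function, the
  distribution function of the Gamma(n,1) law. \<open>gammaP n (t^2)\<close> is the base of the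
  power in \<open>fT n t\<close>.\<close>

definition gammaP :: "nat \<Rightarrow> real \<Rightarrow> real" where
  "gammaP n s = 1 - exp (- s) * (\<Sum>k<n. s ^ k / fact k)"

lemma nn_integral_min_power_exp:
  assumes "0 < s"
  shows "(\<integral>\<^sup>+t. ennreal (min t s ^ n * exp (- t)) * indicator {0..} t \<partial>lborel)
    = ennreal (fact n * gammaP n s)"
proof -
  have "(\<integral>\<^sup>+t. ennreal (min t s ^ n * exp (- t)) * indicator {0..} t \<partial>lborel)
     = (\<integral>\<^sup>+t. ennreal (t ^ n * exp (- t)) * indicator {0..s} t + ennreal (s ^ n) * (ennreal (exp (- t)) * indicator {s..} t) \<partial>lborel)"
  proof (rule nn_integral_cong_AE)
    show "AE t in lborel. ennreal (min t s ^ n * exp (- t)) * indicator {0..} t =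
      ennreal (t ^ n * exp (- t)) * indicator {0..s} t + ennreal (s ^ n) * (ennreal (exp (- t)) * indicator {s..} t)"
      using AE_lborel_singleton[of s]
    proof eventually_elim
      case (elim t)
      consider "t < 0" | "0 \<le> t" "t < s" | "s < t" using elim by linarith
      then show ?case
        by cases (use assms in \<open>simp_all add: ennreal_mult\<close>)
    qed
  qed
  also have "\<dots> = ennreal ((1 - (\<Sum>k\<le>n. (s ^ k * exp (- s)) / fact k)) * fact n) + ennreal (s ^ n) * ennreal (exp (- s))"
    using assms by (subst nn_integral_add)
      (simp_all add: nn_intergal_power_times_exp_Icc nn_integral_cmult exp_tail)
  also have "ennreal (s ^ n) * ennreal (exp (- s)) = ennreal (s ^ n * exp (- s))"
    using assms by (simp add: ennreal_mult)
  also have "ennreal ((1 - (\<Sum>k\<le>n. (s ^ k * exp (- s)) / fact k)) * fact n) + ennreal (s ^ n * exp (- s))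
     = ennreal ((1 - (\<Sum>k\<le>n. (s ^ k * exp (- s)) / fact k)) * fact n + s ^ n * exp (- s))"
  proof (rule ennreal_plus[symmetric])
    have "0 \<le> erlang_CDF n 1 s" using assms by (intro erlang_CDF_nonneg) auto
    then show "0 \<le> (1 - (\<Sum>k\<le>n. (s ^ k * exp (- s)) / fact k)) * fact n"
      using assms by (simp add: erlang_CDF_def)
  qed (use assms in auto)
  \<comment> \<open>The contribution \<open>s ^ n * exp (- s)\<close> of the part beyond
    \<open>s\<close> cancels the summand \<open>k = n\<close>, which leaves the sum over
    \<open>k < n\<close>.\<close>
  also have "(1 - (\<Sum>k\<le>n. (s ^ k * exp (- s)) / fact k)) * fact n + s ^ n * exp (- s) = fact n * gammaP n s"
    by (simp add: gammaP_def lessThan_Suc_atMost[symmetric] field_simps sum_distrib_left)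
  finally show ?thesis .
qed

text \<open>The layer formula is applied to \<open>{..s}\<close> with threshold
  \<open>min t s\<close> and to the whole line with threshold \<open>t\<close>. The volume of the
  cone is the same constant in both and can be eliminated; this makes the norm independent of the
  direction.\<close>

lemma gauss_cone_sqn_le:
  assumes "cone n A" "0 < s"
  shows "emeasure (gauss n) {z \<in> A. sqn n z \<le> s} = emeasure (gauss n) A * ennreal (gammaP n s)"
proof -
  let ?K = "ennreal (1 / pi ^ n) * emeasure (leb n) {z \<in> A. sqn n z \<le> 1}"
  have "emeasure (gauss n) {z \<in> A. sqn n z \<in> {..s}} = ?K * ennreal (fact n * gammaP n s)"
    using assms by (subst gauss_cone_layer[where m="\<lambda>t. min t s"]) (auto simp: nn_integral_min_power_exp)
  moreover have "emeasure (gauss n) {z \<in> A. sqn n z \<in> UNIV} = ?K * ennreal (fact n)"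
    using assms nn_intergal_power_times_exp_Ici[of n]
    by (subst gauss_cone_layer[where m="\<lambda>t. t"]) auto
  ultimately show ?thesis
    by (simp add: ennreal_mult' mult.assoc)
qed

lemma gammaP_Suc: "gammaP (Suc n) s = gammaP n s - exp (- s) * (s ^ n / fact n)"
  by (simp add: gammaP_def algebra_simps)

text \<open>The derivatives telescope: differentiating the new summand cancels the previous density
  and leaves the next one.\<close>

lemma gammaP_deriv: "(gammaP (Suc n) has_real_derivative exp (- s) * s ^ n / fact n) (at s)"
proof (induction n)
  case 0
  show ?case
    by (auto simp: gammaP_def[abs_def] intro!: derivative_eq_intros)
next
  case (Suc n)
  have "((\<lambda>s. gammaP (Suc n) s - exp (- s) * (s ^ Suc n / fact (Suc n))) has_real_derivative
      exp (- s) * s ^ n / fact n - (exp (- s) * (of_nat (Suc n) * s ^ n / fact (Suc n)) - exp (- s) * (s ^ Suc n / fact (Suc n)))) (at s)"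
    by (rule derivative_eq_intros Suc refl | simp)+
  moreover have "(of_nat (Suc n) * s ^ n / fact (Suc n)) = s ^ n / fact n"
    by (simp add: divide_simps del: of_nat_Suc)
  ultimately show ?case
    by (simp add: gammaP_Suc[of "Suc n", abs_def])
qed

lemma gammaP_strict_mono:
  assumes "0 < n" "0 \<le> s" "s < t"
  shows "gammaP n s < gammaP n t"
proof -
  obtain m where n: "n = Suc m" using assms by (cases n) auto
  obtain x where "s < x" "x < t" "gammaP n t - gammaP n s = (t - s) * (exp (- x) * x ^ m / fact m)"
    using MVT2[OF \<open>s < t\<close>, of "gammaP n" "\<lambda>x. exp (- x) * x ^ m / fact m"] gammaP_deriv n by blast
  moreover from this have "0 < (t - s) * (exp (- x) * x ^ m / fact m)" using assms by simp
  ultimately show ?thesis by linarith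
qed

lemma gammaP_0: "0 < n \<Longrightarrow> gammaP n 0 = 0"
  by (cases n) (simp_all add: gammaP_def sum.lessThan_Suc_shift del: sum.lessThan_Suc)

lemma gammaP_nonneg: "0 < n \<Longrightarrow> 0 \<le> s \<Longrightarrow> 0 \<le> gammaP n s"
  using gammaP_strict_mono[of n 0 s] gammaP_0[of n] by (cases "s = 0") auto

lemma gammaP_tendsto: "(gammaP n \<longlongrightarrow> 1) at_top"
proof -
  have *: "((\<lambda>s::real. (s ^ k / exp s) / fact k) \<longlongrightarrow> (0 :: real) / fact k) at_top" for k
    by (rule tendsto_divide[OF tendsto_power_div_exp_0 tendsto_const]) simp
  have "((\<lambda>s::real. 1 - (\<Sum>k<n. (s ^ k / exp s) / fact k)) \<longlongrightarrow> 1 - (\<Sum>k<n. 0 / fact k)) at_top"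
    by (intro tendsto_diff tendsto_const tendsto_sum *)
  moreover have "gammaP n = (\<lambda>s. 1 - (\<Sum>k<n. (s ^ k / exp s) / fact k))"
    by (auto simp: gammaP_def sum_distrib_left exp_minus field_simps)
  ultimately show ?thesis by simp
qed

lemma gammaP_continuous: "continuous_on X (gammaP n)"
  unfolding gammaP_def[abs_def] by (intro continuous_intros) simp

lemma gammaP_le_iff:
  assumes n: "0 < n" and u: "0 < u" "u < 1"
  shows "\<exists>s>0. \<forall>r\<ge>0. gammaP n r \<le> u \<longleftrightarrow> r \<le> s"
proof -
  have "eventually (\<lambda>s. u < gammaP n s \<and> 0 < s) at_top"
    using order_tendstoD(1)[OF gammaP_tendsto u(2)] eventually_gt_at_top[of 0] by (rule eventually_conj)
  then obtain b where b: "u < gammaP n b" "0 < b" by (auto dest: eventually_happens)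
  have "\<exists>s. 0 \<le> s \<and> s \<le> b \<and> gammaP n s = u"
    using b u gammaP_0[OF n] by (intro IVT') (auto intro: gammaP_continuous)
  then obtain s where s: "0 \<le> s" "gammaP n s = u" by auto
  moreover have "s \<noteq> 0" using s u gammaP_0[OF n] by auto
  moreover have "gammaP n r \<le> u \<longleftrightarrow> r \<le> s" if "0 \<le> r" for r
    using gammaP_strict_mono[OF n, of r s] gammaP_strict_mono[OF n, of s r] s that by force
  ultimately show ?thesis by (intro exI[of _ s]) auto
qed

section \<open>A criterion for a uniform variable independent of another one\<close>

abbreviation unif :: "real measure" where
  "unif \<equiv> uniform_measure lborel {0<..<1}"

lemma prob_space_unif: "prob_space unif"
  by (rule prob_space_uniform_measure) simp_all

text \<open>Serves the two ends of the unit interval, which are reached only as limits from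
  inside.\<close>

lemma le_of_arbitrarily_close:
  fixes a b :: real
  assumes "\<And>v. 0 < v \<Longrightarrow> v < 1 \<Longrightarrow> a \<le> b + v"
  shows "a \<le> b"
proof (rule field_le_epsilon)
  fix e :: real assume "0 < e"
  then show "a \<le> b + e" using assms[of e] assms[of "1 / 2"] by (cases "e < 1") auto
qed

text \<open>For fixed \<open>A\<close> both sides are finite measures on the real line and so are
  determined by the half lines \<open>{u<..}\<close>. For \<open>0 < u < 1\<close> the hypothesis
  gives their mass; monotonicity and a limit extend this to all \<open>u\<close>, which also shows
  that no mass lies outside the unit interval.\<close>

lemma joint_uniform:
  fixes \<rho> :: "'a \<Rightarrow> real"
  assumes "prob_space M" and [measurable]: "X \<in> measurable M N" "\<rho> \<in> borel_measurable M"
    and eq: "\<And>A u. A \<in> sets N \<Longrightarrow> 0 < u \<Longrightarrow> u < 1 \<Longrightarrow>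
      emeasure M {x \<in> space M. X x \<in> A \<and> \<rho> x \<le> u} = emeasure M {x \<in> space M. X x \<in> A} * ennreal u"
  shows "distr M (N \<Otimes>\<^sub>M borel) (\<lambda>x. (X x, \<rho> x)) = distr M N X \<Otimes>\<^sub>M unif"
proof (rule pair_measure_eqI[symmetric])
  interpret prob_space M by fact
  interpret U: prob_space unif by (rule prob_space_unif)
  show "sigma_finite_measure (distr M N X)"
    by (intro prob_space_imp_sigma_finite prob_space_distr) simp
  show "sigma_finite_measure unif" by (intro prob_space_imp_sigma_finite prob_space_unif)
  show "sets (distr M N X \<Otimes>\<^sub>M unif) = sets (distr M (N \<Otimes>\<^sub>M borel) (\<lambda>x. (X x, \<rho> x)))"
    by (simp cong: sets_pair_measure_cong)
  fix A B assume "A \<in> sets (distr M N X)" "B \<in> sets unif"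
  then have A [measurable]: "A \<in> sets N" and B [measurable]: "B \<in> sets borel" by auto
  define p where "p = prob {x \<in> space M. X x \<in> A}"
  define q where "q u = prob {x \<in> space M. X x \<in> A \<and> u < \<rho> x}" for u
  have p: "0 \<le> p" "p \<le> 1" by (simp_all add: p_def)
  have q_inner: "q u = p * (1 - u)" if u: "0 < u" "u < 1" for u
  proof -
    have "prob {x \<in> space M. X x \<in> A \<and> \<rho> x \<le> u} = p * u"
      using eq[OF A u] u p by (simp add: emeasure_eq_measure p_def flip: ennreal_mult)
    moreover have "prob {x \<in> space M. X x \<in> A} = prob {x \<in> space M. X x \<in> A \<and> \<rho> x \<le> u} + q u"
      unfolding q_def by (subst finite_measure_Union[symmetric]) (auto intro!: arg_cong[where f=prob])
    ultimately show ?thesis by (simp add: p_def algebra_simps)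
  qed
  have q_mono: "q v \<le> q u" if "u \<le> v" for u v
    unfolding q_def using that by (intro finite_measure_mono) auto
  have q_le: "q u \<le> p" for u
    unfolding q_def p_def by (intro finite_measure_mono) auto
  have q: "q u = p * measure unif {u<..}" for u
  proof -
    consider "u \<le> 0" | "0 < u" "u < 1" | "1 \<le> u" by linarith
    then show ?thesis
    proof cases
      case 1
      then have "{0<..<1} \<inter> {u<..} = {0<..<1}" by auto
      then have "measure unif {u<..} = 1" by (simp add: measure_def)
      moreover have "p \<le> q u"
      proof (rule le_of_arbitrarily_close)
        fix v :: real assume v: "0 < v" "v < 1"
        have "p * v \<le> v" using p v by (simp add: mult_left_le_one_le)
        moreover have "q v = p - p * v" using q_inner[OF v] by (simp add: algebra_simps)
        ultimately show "p \<le> q u + v" using q_mono[of u v] 1 v by linarith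
      qed
      ultimately show ?thesis using q_le[of u] by simp
    next
      case 2
      then have "{0<..<1} \<inter> {u<..} = {u<..<1}" by auto
      then have "measure unif {u<..} = 1 - u" using 2 by (simp add: measure_def divide_ennreal_def)
      then show ?thesis using q_inner[OF 2] by simp
    next
      case 3
      then have "{0<..<1} \<inter> {u<..} = {}" by auto
      then have "measure unif {u<..} = 0" by (simp add: measure_def)
      moreover have "q u \<le> 0"
      proof (rule le_of_arbitrarily_close)
        fix v :: real assume v: "0 < v" "v < 1"
        have "p * v \<le> v" using p v by (simp add: mult_left_le_one_le)
        moreover have "q (1 - v) = p * v" using q_inner[of "1 - v"] v by simp
        ultimately show "q u \<le> 0 + v" using q_mono[of "1 - v" u] 3 v by linarith
      qed
      ultimately show ?thesis by (simp add: q_def measure_nonneg antisym)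
    qed
  qed
  \<comment> \<open>The law of \<open>\<rho>\<close> restricted to the event that \<open>X\<close>
    lies in \<open>A\<close>.\<close>
  define MA where "MA = distr (density M (indicator (X -` A \<inter> space M))) borel \<rho>"
  have MA: "emeasure MA C = emeasure M {x \<in> space M. X x \<in> A \<and> \<rho> x \<in> C}" if [measurable]: "C \<in> sets borel" for C
  proof -
    have "emeasure MA C = (\<integral>\<^sup>+x. indicator {x \<in> space M. X x \<in> A \<and> \<rho> x \<in> C} x \<partial>M)"
      unfolding MA_def
      by (subst emeasure_distr, simp, simp, subst emeasure_density, simp, simp, rule nn_integral_cong)
         (auto simp: indicator_def)
    then show ?thesis by simp
  qed
  have "MA = scale_measure (ennreal p) unif"
  proof (rule measure_eqI_lessThan)
    fix u
    have *: "emeasure MA {u<..} = ennreal (q u)"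
      by (subst MA) (simp_all add: q_def emeasure_eq_measure)
    then show "emeasure MA {u<..} < \<infinity>" by simp
    show "emeasure MA {u<..} = emeasure (scale_measure (ennreal p) unif) {u<..}"
      by (simp only: * q emeasure_scale_measure U.emeasure_eq_measure ennreal_mult''[OF measure_nonneg])
  qed (simp_all add: MA_def)
  then have "emeasure MA B = ennreal p * emeasure unif B" by simp
  then have *: "emeasure M {x \<in> space M. X x \<in> A \<and> \<rho> x \<in> B} = ennreal p * emeasure unif B"
    by (simp only: MA[OF B])
  have "emeasure (distr M N X) A = ennreal p"
    by (subst emeasure_distr) (auto simp: p_def emeasure_eq_measure intro!: arg_cong[where f=prob])
  moreover have "emeasure (distr M (N \<Otimes>\<^sub>M borel) (\<lambda>x. (X x, \<rho> x))) (A \<times> B)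
      = emeasure M {x \<in> space M. X x \<in> A \<and> \<rho> x \<in> B}"
    by (subst emeasure_distr) (auto intro!: arg_cong[where f="emeasure M"])
  ultimately show "emeasure (distr M N X) A * emeasure unif B
      = emeasure (distr M (N \<Otimes>\<^sub>M borel) (\<lambda>x. (X x, \<rho> x))) (A \<times> B)"
    by (simp only: *)
qed


text \<open>Division by zero yields 0, so the zero vector has direction 0. This agrees with the
  value of \<open>wvec\<close> at \<open>z = 0\<close>.\<close>

definition dir :: "nat \<Rightarrow> (nat \<Rightarrow> complex) \<Rightarrow> nat \<Rightarrow> complex" where
  "dir n z = (\<lambda>i\<in>{..<n}. complex_of_real (1 / sqrt (sqn n z)) * z i)"

lemma dir_measurable [measurable]: "dir n \<in> measurable (leb n) (leb n)"
  unfolding dir_def by (rule leb_restrict_measurable) measurable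

lemma cone_dir:
  assumes [measurable]: "A \<in> sets (leb n)"
  shows "cone n {z \<in> space (leb n). dir n z \<in> A}"
  unfolding cone_def
proof (intro conjI allI impI)
  fix c :: real and z assume c: "0 < c" and z: "z \<in> space (leb n)"
  have "dir n (\<lambda>i\<in>{..<n}. complex_of_real c * z i) = dir n z"
    using c by (auto simp: dir_def sqn_scale real_sqrt_mult intro!: restrict_ext)
  then show "(\<lambda>i\<in>{..<n}. complex_of_real c * z i) \<in> {z \<in> space (leb n). dir n z \<in> A} \<longleftrightarrow>
      z \<in> {z \<in> space (leb n). dir n z \<in> A}"
    using z by (simp add: space_leb)
qed measurable

text \<open>The uniform law on the unit sphere of \<complex>^n when \<open>n > 0\<close>. It enters
  only as a common factor of the two polar decompositions.\<close>

definition dirlaw :: "nat \<Rightarrow> (nat \<Rightarrow> complex) measure" where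
  "dirlaw n = distr (gauss n) (leb n) (dir n)"

lemma gauss_polar:
  assumes n: "0 < n"
  shows "distr (gauss n) (leb n \<Otimes>\<^sub>M borel) (\<lambda>z. (dir n z, gammaP n (sqn n z))) = dirlaw n \<Otimes>\<^sub>M unif"
  unfolding dirlaw_def
proof (rule joint_uniform)
  show "prob_space (gauss n)" by (rule prob_space_gauss)
  show "dir n \<in> measurable (gauss n) (leb n)" by measurable
  show "(\<lambda>z. gammaP n (sqn n z)) \<in> borel_measurable (gauss n)"
    unfolding gammaP_def by measurable
  fix A u assume [measurable]: "A \<in> sets (leb n)" and u: "0 < u" "u < (1::real)"
  obtain s where s: "s > 0" "\<And>r. r \<ge> 0 \<Longrightarrow> gammaP n r \<le> u \<longleftrightarrow> r \<le> s" "gammaP n s = u"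
  proof -
    obtain s where s: "s > 0" "\<forall>r\<ge>0. gammaP n r \<le> u \<longleftrightarrow> r \<le> s"
      using gammaP_le_iff[OF n u] by blast
    \<comment> \<open>Otherwise continuity would keep \<open>gammaP n\<close> below \<open>u\<close>
      slightly to the right of \<open>s\<close>, against the choice of \<open>s\<close>.\<close>
    have "\<not> gammaP n s < u"
    proof
      assume *: "gammaP n s < u"
      have "((\<lambda>r. gammaP n r) \<longlongrightarrow> gammaP n s) (at_right s)"
        using gammaP_continuous[of UNIV n] by (simp add: continuous_on_def filterlim_at_split)
      then have "eventually (\<lambda>r. gammaP n r < u) (at_right s)" using * by (rule order_tendstoD)
      then obtain r where "s < r" "gammaP n r < u"
        using eventually_at_right_field by (metis dense)
      moreover have "gammaP n r \<le> u \<longleftrightarrow> r \<le> s" using s \<open>s < r\<close> by auto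
      ultimately show False by simp
    qed
    moreover have "gammaP n s \<le> u" using s by simp
    ultimately have "gammaP n s = u" by simp
    with s show ?thesis by (intro that[of s]) auto
  qed
  have "{z \<in> space (gauss n). dir n z \<in> A \<and> gammaP n (sqn n z) \<le> u}
      = {z \<in> {z \<in> space (leb n). dir n z \<in> A}. sqn n z \<le> s}"
    using s by auto
  then show "emeasure (gauss n) {z \<in> space (gauss n). dir n z \<in> A \<and> gammaP n (sqn n z) \<le> u}
      = emeasure (gauss n) {z \<in> space (gauss n). dir n z \<in> A} * ennreal u"
    using gauss_cone_sqn_le[OF cone_dir[OF \<open>A \<in> sets (leb n)\<close>] \<open>s > 0\<close>] s(3) by simp
qed

text \<open>\<open>gammaP 1 s = 1 - exp (- s)\<close>: the squared modulus of one coordinate is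
  exponentially distributed. The cone formula, for the cone of all vectors, gives the strict tail;
  the closed one follows by a limit.\<close>

lemma gauss1_tail:
  assumes "0 \<le> a"
  shows "emeasure gauss1 {x. a \<le> (cmod x)\<^sup>2} = ennreal (exp (- a))"
proof (cases "a = 0")
  case True
  then show ?thesis using prob_space.emeasure_space_1[OF prob_space_gauss1] by simp
next
  case False
  then have a: "0 < a" using assms by simp
  interpret prob_space gauss1 by (rule prob_space_gauss1)
  have gt: "prob {x. s < (cmod x)\<^sup>2} = exp (- s)" if s: "0 < s" for s
  proof -
    have "cone 1 (space (leb 1))"
      unfolding cone_def by (intro conjI sets.top) (simp add: space_leb)
    from gauss_cone_sqn_le[OF this s]
    have "emeasure (gauss 1) {z \<in> space (leb 1). (cmod (z 0))\<^sup>2 \<le> s} = ennreal (1 - exp (- s))"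
      using prob_space.emeasure_space_1[OF prob_space_gauss[of 1]]
      by (simp add: gammaP_def sqn_def)
    moreover have "emeasure gauss1 {x. (cmod x)\<^sup>2 \<le> s} = (\<integral>\<^sup>+x. indicator {x. (cmod x)\<^sup>2 \<le> s} x \<partial>gauss1)"
      by simp
    moreover have "\<dots> = (\<integral>\<^sup>+z. indicator {x. (cmod x)\<^sup>2 \<le> s} (z 0) \<partial>gauss 1)"
      by (rule nn_integral_gauss1) simp
    moreover have "\<dots> = (\<integral>\<^sup>+z. indicator {z \<in> space (leb 1). (cmod (z 0))\<^sup>2 \<le> s} z \<partial>gauss 1)"
      by (intro nn_integral_cong) (simp add: indicator_def)
    moreover have "\<dots> = emeasure (gauss 1) {z \<in> space (leb 1). (cmod (z 0))\<^sup>2 \<le> s}"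
      by (rule nn_integral_indicator) simp
    ultimately have "emeasure gauss1 {x. (cmod x)\<^sup>2 \<le> s} = ennreal (1 - exp (- s))" by simp
    then have "prob {x. (cmod x)\<^sup>2 \<le> s} = 1 - exp (- s)"
      using s by (simp add: emeasure_eq_measure)
    moreover have "prob {x \<in> space gauss1. \<not> s < (cmod x)\<^sup>2} = 1 - prob {x \<in> space gauss1. s < (cmod x)\<^sup>2}"
      by (rule prob_neg) simp
    ultimately show ?thesis by (simp add: not_less)
  qed
  let ?p = "prob {x. a \<le> (cmod x)\<^sup>2}"
  have "exp (- a) \<le> ?p"
    unfolding gt[OF a, symmetric] by (intro finite_measure_mono) auto
  \<comment> \<open>The closed tail at \<open>a\<close> lies in the strict tail at every
    \<open>s < a\<close>; then \<open>s\<close> tends to \<open>a\<close>.\<close>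
  moreover have "?p \<le> exp (- a)"
  proof (rule tendsto_lowerbound)
    show "((\<lambda>s. exp (- s)) \<longlongrightarrow> exp (- a)) (at_left a)"
      by (intro tendsto_intros)
    have "eventually (\<lambda>s. 0 < s \<and> s < a) (at_left a)"
      using a eventually_at_left_real by (auto simp: greaterThanLessThan_def greaterThan_def lessThan_def elim: eventually_mono)
    then show "eventually (\<lambda>s. ?p \<le> exp (- s)) (at_left a)"
    proof eventually_elim
      case (elim s)
      then show ?case
        using gt[of s] by (auto intro!: finite_measure_mono simp flip: gt)
    qed
  qed simp
  ultimately show ?thesis by (simp add: emeasure_eq_measure)
qed

text \<open>For fixed \<open>z\<close> the ratio is at most \<open>u\<close> iff
  \<open>|x|^2 \<ge> c |z|^2\<close>, which has probability \<open>exp (- c |z|^2)\<close>. Together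
  with the Gaussian density of \<open>z\<close> this makes \<open>exp (- |z|^2 / q)\<close>, and
  rescaling \<open>z\<close> by \<open>sqrt q\<close> restores the Gaussian at the cost of the
  Jacobian \<open>q ^ n = u\<close>. Cones do not notice the rescaling.\<close>

lemma gauss_polar_ratio:
  assumes n: "0 < n"
  shows "distr (gauss1 \<Otimes>\<^sub>M gauss n) (leb n \<Otimes>\<^sub>M borel)
      (\<lambda>(x, z). (dir n z, (sqn n z / (sqn n z + (cmod x)\<^sup>2)) ^ n)) = dirlaw n \<Otimes>\<^sub>M unif"
proof -
  interpret g1: prob_space gauss1 by (rule prob_space_gauss1)
  interpret gn: prob_space "gauss n" by (rule prob_space_gauss)
  interpret P: pair_prob_space gauss1 "gauss n" ..
  let ?P = "gauss1 \<Otimes>\<^sub>M gauss n"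
  let ?r = "\<lambda>p. (sqn n (snd p) / (sqn n (snd p) + (cmod (fst p))\<^sup>2)) ^ n"
  have marg: "emeasure ?P {p \<in> space ?P. dir n (snd p) \<in> A} = emeasure (gauss n) {z \<in> space (leb n). dir n z \<in> A}"
    if [measurable]: "A \<in> sets (leb n)" for A
  proof -
    have "{p \<in> space ?P. dir n (snd p) \<in> A} = UNIV \<times> {z \<in> space (leb n). dir n z \<in> A}"
      by (auto simp: space_pair_measure)
    then show ?thesis
      using g1.emeasure_space_1 by (simp add: gn.emeasure_pair_measure_Times)
  qed
  have "distr ?P (leb n \<Otimes>\<^sub>M borel) (\<lambda>p. (dir n (snd p), ?r p)) = distr ?P (leb n) (\<lambda>p. dir n (snd p)) \<Otimes>\<^sub>M unif"
  proof (rule joint_uniform)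
    show "prob_space ?P" by (rule P.prob_space_axioms)
    fix A u assume A [measurable]: "A \<in> sets (leb n)" and u: "0 < u" "u < (1::real)"
    define q where "q = root n u"
    have q: "0 < q" "q < 1" "q ^ n = u" using u n by (simp_all add: q_def)
    \<comment> \<open>Solving \<open>s / (s + t) \<le> q\<close> for \<open>t\<close> gives
      \<open>c * s \<le> t\<close>.\<close>
    define c where "c = 1 / q - 1"
    have c: "0 < c" using q by (simp add: c_def)
    let ?A = "{z \<in> space (leb n). dir n z \<in> A}"
    have iff: "(s / (s + t)) ^ n \<le> u \<longleftrightarrow> c * s \<le> t" if "0 \<le> s" "0 \<le> t" for s t
    proof (cases "s + t = 0")
      case True
      then have "s = 0" "t = 0" using that by auto
      then show ?thesis using u n by (simp add: zero_power)
    next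
      case False
      have "(s / (s + t)) ^ n \<le> u \<longleftrightarrow> s / (s + t) \<le> q"
        using q that n unfolding q(3)[symmetric] by (intro power_mono_iff) auto
      also have "\<dots> \<longleftrightarrow> c * s \<le> t"
        using False that q by (simp add: c_def divide_simps) (simp add: algebra_simps)
      finally show ?thesis .
    qed
    let ?E = "{p \<in> space ?P. dir n (snd p) \<in> A \<and> ?r p \<le> u}"
    have "emeasure ?P ?E = (\<integral>\<^sup>+z. emeasure gauss1 ((\<lambda>x. (x, z)) -` ?E) \<partial>gauss n)"
      by (rule P.emeasure_pair_measure_alt2) measurable
    also have "\<dots> = (\<integral>\<^sup>+z. indicator ?A z * ennreal (exp (- (c * sqn n z))) \<partial>gauss n)"
    proof (rule nn_integral_cong)
      fix z assume z: "z \<in> space (gauss n)"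
      then have "(\<lambda>x. (x, z)) -` ?E = (if z \<in> ?A then {x. c * sqn n z \<le> (cmod x)\<^sup>2} else {})"
        by (auto simp: space_pair_measure iff)
      then show "emeasure gauss1 ((\<lambda>x. (x, z)) -` ?E) = indicator ?A z * ennreal (exp (- (c * sqn n z)))"
        using c by (simp add: gauss1_tail)
    qed
    also have "\<dots> = ennreal (1 / pi ^ n) * (\<integral>\<^sup>+z. ennreal (exp (- sqn n z)) * (indicator ?A z * ennreal (exp (- (c * sqn n z)))) \<partial>leb n)"
      by (rule nn_integral_gauss) measurable
    also have "(\<integral>\<^sup>+z. ennreal (exp (- sqn n z)) * (indicator ?A z * ennreal (exp (- (c * sqn n z)))) \<partial>leb n)
      = (\<integral>\<^sup>+z. ennreal (exp (- (sqn n z / q))) * indicator ?A z \<partial>leb n)"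
    proof (rule nn_integral_cong)
      fix z
      have "- sqn n z + - (c * sqn n z) = - (sqn n z / q)" by (simp add: c_def algebra_simps)
      then have "exp (- sqn n z) * exp (- (c * sqn n z)) = exp (- (sqn n z / q))"
        by (simp only: exp_add[symmetric])
      then show "ennreal (exp (- sqn n z)) * (indicator ?A z * ennreal (exp (- (c * sqn n z))))
        = ennreal (exp (- (sqn n z / q))) * indicator ?A z"
        by (simp add: indicator_def flip: ennreal_mult)
    qed
    also have "\<dots> = ennreal (sqrt q ^ (2 * n)) *
      (\<integral>\<^sup>+z. ennreal (exp (- (sqn n (\<lambda>i\<in>{..<n}. complex_of_real (sqrt q) * z i) / q))) *
         indicator ?A (\<lambda>i\<in>{..<n}. complex_of_real (sqrt q) * z i) \<partial>leb n)"
      using q by (intro leb_scale) auto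
    also have "(\<integral>\<^sup>+z. ennreal (exp (- (sqn n (\<lambda>i\<in>{..<n}. complex_of_real (sqrt q) * z i) / q))) *
         indicator ?A (\<lambda>i\<in>{..<n}. complex_of_real (sqrt q) * z i) \<partial>leb n)
       = (\<integral>\<^sup>+z. ennreal (exp (- sqn n z)) * indicator ?A z \<partial>leb n)"
    proof (rule nn_integral_cong)
      fix z assume "z \<in> space (leb n)"
      then have "((\<lambda>i\<in>{..<n}. complex_of_real (sqrt q) * z i) \<in> ?A) = (z \<in> ?A)"
        using cone_dir[OF A] q unfolding cone_def by simp
      then show "ennreal (exp (- (sqn n (\<lambda>i\<in>{..<n}. complex_of_real (sqrt q) * z i) / q))) *
         indicator ?A (\<lambda>i\<in>{..<n}. complex_of_real (sqrt q) * z i) = ennreal (exp (- sqn n z)) * indicator ?A z"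
        using q by (simp only: indicator_def) (simp add: sqn_scale)
    qed
    also have "sqrt q ^ (2 * n) = u" using q by (simp add: power_mult)
    also have "ennreal (1 / pi ^ n) * (ennreal u * (\<integral>\<^sup>+z. ennreal (exp (- sqn n z)) * indicator ?A z \<partial>leb n))
      = (\<integral>\<^sup>+z. indicator ?A z \<partial>gauss n) * ennreal u"
      by (subst nn_integral_gauss) (simp_all add: mult_ac)
    finally show "emeasure ?P ?E = emeasure ?P {p \<in> space ?P. dir n (snd p) \<in> A} * ennreal u"
      by (simp add: marg)
  qed measurable
  also have "distr ?P (leb n) (\<lambda>p. dir n (snd p)) = dirlaw n"
  proof (rule measure_eqI)
    fix A assume "A \<in> sets (distr ?P (leb n) (\<lambda>p. dir n (snd p)))"
    then have [measurable]: "A \<in> sets (leb n)" by simp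
    show "emeasure (distr ?P (leb n) (\<lambda>p. dir n (snd p))) A = emeasure (dirlaw n) A"
      using marg[of A] by (simp add: emeasure_distr dirlaw_def vimage_def Int_def conj_commute)
  qed (simp add: dirlaw_def)
  finally show ?thesis by (simp add: split_beta')
qed

section \<open>Complex lines and their projection matrices\<close>

lemma space_cvecM: "space (cvecM T) = extensional {..<T}"
  using sets_eq_imp_space_eq[OF sets_leb] by (simp add: space_leb)

lemma nonzero_vec_iff: "nonzero_vec T x \<longleftrightarrow> 0 < sqn T x"
proof -
  have "sqn T x = 0 \<longleftrightarrow> (\<forall>i<T. x i = 0)"
    by (auto simp: sqn_def sum_nonneg_eq_0_iff)
  then show ?thesis
    using sqn_nonneg[of T x] by (auto simp: nonzero_vec_def less_le)
qed

lemma nonzero_vec_measurable [measurable]: "Measurable.pred (leb T) (nonzero_vec T)"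
  unfolding nonzero_vec_iff[abs_def] by measurable

definition preim :: "nat \<Rightarrow> (nat \<Rightarrow> complex) set set \<Rightarrow> (nat \<Rightarrow> complex) set" where
  "preim T S = {x \<in> space (leb T). nonzero_vec T x \<and> line T x \<in> S}"

lemma lines_iff: "L \<in> lines T \<longleftrightarrow> (\<exists>x. x \<in> extensional {..<T} \<and> nonzero_vec T x \<and> L = line T x)"
  by (auto simp: lines_def space_cvecM)

lemma lines_measure_alt:
  "lines_measure T = measure_of (lines T) {S. S \<subseteq> lines T \<and> preim T S \<in> sets (leb T)} (\<lambda>_. 0)"
  unfolding lines_measure_def preim_def by (simp add: space_cvecM space_leb sets_leb)

text \<open>The family generating \<open>lines_measure\<close> is already closed, because preimages
  commute with unions and with complements relative to the nonzero vectors. Hence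
  \<open>sets_lines\<close> describes all measurable sets and not merely generators.\<close>

lemma sigma_algebra_lines: "sigma_algebra (lines T) {S. S \<subseteq> lines T \<and> preim T S \<in> sets (leb T)}"
  unfolding sigma_algebra_iff2
proof (intro conjI allI ballI impI)
  fix S assume S: "S \<in> {S. S \<subseteq> lines T \<and> preim T S \<in> sets (leb T)}"
  have "preim T (lines T - S) = {x \<in> space (leb T). nonzero_vec T x} - preim T S"
    by (auto simp: preim_def lines_iff space_leb)
  then show "lines T - S \<in> {S. S \<subseteq> lines T \<and> preim T S \<in> sets (leb T)}"
    using S by auto
next
  fix A :: "nat \<Rightarrow> _" assume A: "range A \<subseteq> {S. S \<subseteq> lines T \<and> preim T S \<in> sets (leb T)}"
  have "preim T (\<Union>i. A i) = (\<Union>i. preim T (A i))"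
    by (auto simp: preim_def)
  moreover have "preim T (A i) \<in> sets (leb T)" "A i \<subseteq> lines T" for i
    using A by auto
  ultimately show "(\<Union>i. A i) \<in> {S. S \<subseteq> lines T \<and> preim T S \<in> sets (leb T)}"
    by (simp add: UN_least sets.countable_UN' image_subset_iff)
qed (auto simp: preim_def)

lemma sets_lines: "sets (lines_measure T) = {S. S \<subseteq> lines T \<and> preim T S \<in> sets (leb T)}"
  unfolding lines_measure_alt
  by (subst sets_measure_of) (auto simp: sigma_algebra.sigma_sets_eq[OF sigma_algebra_lines])

lemma space_lines [simp]: "space (lines_measure T) = lines T"
  unfolding lines_measure_alt by (subst space_measure_of) auto

lemma line_scale:
  assumes "c \<noteq> 0" shows "line T (\<lambda>i\<in>{..<T}. c * x i) = line T x"
proof -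
  have "\<exists>d. (\<lambda>i\<in>{..<T}. e * x i) = (\<lambda>i\<in>{..<T}. d * (\<lambda>i\<in>{..<T}. c * x i) i) \<and> d \<noteq> 0" if "e \<noteq> 0" for e
    using assms that by (intro exI[of _ "e / c"]) auto
  moreover have "\<exists>d. (\<lambda>i\<in>{..<T}. e * (\<lambda>i\<in>{..<T}. c * x i) i) = (\<lambda>i\<in>{..<T}. d * x i) \<and> d \<noteq> 0" if "e \<noteq> 0" for e
    using assms that by (intro exI[of _ "e * c"]) (auto simp: mult.assoc)
  ultimately show ?thesis unfolding line_def by blast
qed

lemma line_restrict: "line T (restrict x {..<T}) = line T x"
  using line_scale[of 1 T x] by simp

lemma line_act_line: "line_act T U (line T x) = line T (mat_apply T U x)"
proof -
  have "line T x = (\<lambda>c. \<lambda>i\<in>{..<T}. c * x i) ` {c. c \<noteq> 0}" for x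
    unfolding line_def by auto
  then show ?thesis
    by (simp add: line_act_def image_image mat_apply_linear)
qed

definition unitvec :: "nat \<Rightarrow> nat \<Rightarrow> complex" where
  "unitvec T = (\<lambda>i\<in>{..<T}. if i = 0 then 1 else 0)"

text \<open>\<open>line\<close> made total: the zero vector, which spans no line, is sent to the line of the
  first unit vector.\<close>

definition nzvec :: "nat \<Rightarrow> (nat \<Rightarrow> complex) \<Rightarrow> nat \<Rightarrow> complex" where
  "nzvec T x = (if nonzero_vec T x then x else unitvec T)"

definition tline :: "nat \<Rightarrow> (nat \<Rightarrow> complex) \<Rightarrow> (nat \<Rightarrow> complex) set" where
  "tline T x = line T (nzvec T x)"

lemma nonzero_nzvec: "0 < T \<Longrightarrow> nonzero_vec T (nzvec T x)"
  by (auto simp: nzvec_def nonzero_vec_def unitvec_def)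

lemma nzvec_measurable [measurable]: "nzvec T \<in> measurable (leb T) (leb T)"
proof -
  have [simp]: "unitvec T \<in> space (leb T)" by (simp add: space_leb unitvec_def)
  show ?thesis unfolding nzvec_def by measurable
qed

lemma tline_in_lines:
  assumes "0 < T" shows "tline T x \<in> lines T"
proof -
  have "tline T x = line T (restrict (nzvec T x) {..<T})"
    by (simp add: line_restrict tline_def)
  then show ?thesis
    using nonzero_nzvec[OF assms, of x] unfolding lines_iff
    by (intro exI[of _ "restrict (nzvec T x) {..<T}"]) (auto simp: nonzero_vec_def)
qed

lemma tline_measurable:
  assumes "0 < T" shows "tline T \<in> measurable (leb T) (lines_measure T)"
proof (rule measurableI)
  fix S assume "S \<in> sets (lines_measure T)"
  then have [measurable]: "preim T S \<in> sets (leb T)" by (simp add: sets_lines)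
  have "tline T -` S \<inter> space (leb T) = preim T S \<union>
      (if line T (unitvec T) \<in> S then {x \<in> space (leb T). \<not> nonzero_vec T x} else {})"
    by (auto simp: preim_def tline_def nzvec_def split: if_splits)
  then show "tline T -` S \<inter> space (leb T) \<in> sets (leb T)" by simp
qed (use assms tline_in_lines in auto)

text \<open>The universal property of the quotient sigma algebra: a map on lines is tested on
  vectors. Restricting to nonzero vectors removes the default value of \<open>tline\<close>.\<close>

lemma measurable_from_lines:
  assumes [measurable]: "(\<lambda>x. f (tline T x)) \<in> measurable (leb T) N" and f: "f \<in> lines T \<rightarrow> space N"
  shows "f \<in> measurable (lines_measure T) N"
proof (rule measurableI)
  fix A assume [measurable]: "A \<in> sets N"
  have "preim T (f -` A \<inter> lines T) = {x \<in> space (leb T). nonzero_vec T x \<and> f (tline T x) \<in> A}"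
    by (auto simp: preim_def tline_def nzvec_def lines_iff space_leb)
  also have "\<dots> \<in> sets (leb T)" by measurable
  finally show "f -` A \<inter> space (lines_measure T) \<in> sets (lines_measure T)"
    by (simp add: sets_lines)
qed (use f in auto)

text \<open>An arbitrary choice, for which no measurability is claimed: it is used through
  \<open>proj\<close>, which does not change when the vector is scaled.\<close>

definition lrep :: "nat \<Rightarrow> (nat \<Rightarrow> complex) set \<Rightarrow> nat \<Rightarrow> complex" where
  "lrep T L = (SOME x. x \<in> L)"

lemma lrep_line: "\<exists>c. c \<noteq> 0 \<and> lrep T (line T x) = (\<lambda>i\<in>{..<T}. c * x i)"
proof -
  have "(\<lambda>i\<in>{..<T}. 1 * x i) \<in> line T x" unfolding line_def by force
  then have "lrep T (line T x) \<in> line T x" unfolding lrep_def by (rule someI[of "\<lambda>y. y \<in> line T x"])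
  then show ?thesis by (auto simp: line_def)
qed

text \<open>A line is encoded by the matrix \<open>x x\<^sup>* / |x|\<^sup>2\<close> of the orthogonal projection onto it,
  extended by zero to an infinite matrix.\<close>

definition proj :: "nat \<Rightarrow> (nat \<Rightarrow> complex) \<Rightarrow> nat \<times> nat \<Rightarrow> complex" where
  "proj T x p = (if fst p < T \<and> snd p < T then x (fst p) * cnj (x (snd p)) / complex_of_real (sqn T x) else 0)"

definition projL :: "nat \<Rightarrow> (nat \<Rightarrow> complex) set \<Rightarrow> nat \<times> nat \<Rightarrow> complex" where
  "projL T L = proj T (lrep T L)"

lemma proj_scale:
  assumes "c \<noteq> 0" shows "proj T (\<lambda>i\<in>{..<T}. c * x i) = proj T x"
proof
  fix p
  have "complex_of_real (sqn T (\<lambda>i\<in>{..<T}. c * x i)) = c * cnj c * complex_of_real (sqn T x)"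
    by (simp add: sqn_scale complex_norm_square del: of_real_power)
  then show "proj T (\<lambda>i\<in>{..<T}. c * x i) p = proj T x p"
    using assms by (simp add: proj_def)
qed

lemma projL_line: "projL T (line T x) = proj T x"
  using lrep_line[of T x] proj_scale unfolding projL_def by metis

lemma projL_measurable [measurable]: "projL T \<in> borel_measurable (lines_measure T)"
proof (rule measurable_from_lines)
  have "(\<lambda>x. proj T x p) \<in> borel_measurable (leb T)" for p
  proof (cases "fst p < T \<and> snd p < T")
    case True
    then have [measurable]: "fst p < T" "snd p < T" by auto
    have [measurable]: "cnj \<in> borel_measurable borel"
      by (intro borel_measurable_continuous_onI continuous_intros)
    show ?thesis using True unfolding proj_def by simp
  qed (auto simp: proj_def)
  then have "proj T \<in> borel_measurable (leb T)"
    by (rule measurable_coordinatewise_then_product)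
  then show "(\<lambda>x. projL T (tline T x)) \<in> borel_measurable (leb T)"
    unfolding tline_def projL_line by (rule measurable_compose[OF nzvec_measurable])
qed simp

text \<open>Column \<open>j\<close> of the projection onto \<open>[x]\<close> is
  \<open>cnj (x j) / |x|^2\<close> times \<open>x\<close>, so it spans the line as soon as the
  diagonal entry at \<open>j\<close> is nonzero. Taking the least such \<open>j\<close> keeps the
  choice measurable.\<close>

definition column :: "nat \<Rightarrow> (nat \<times> nat \<Rightarrow> complex) \<Rightarrow> nat \<Rightarrow> complex" where
  "column T Q = (\<lambda>i\<in>{..<T}. Q (i, LEAST j. Q (j, j) \<noteq> 0))"

lemma column_measurable [measurable]: "column T \<in> measurable borel (leb T)"
proof -
  have [measurable]: "(\<lambda>Q :: nat \<times> nat \<Rightarrow> complex. Q p) \<in> borel_measurable borel" for p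
    by (rule measurable_product_coordinates)
  have "(\<lambda>Q :: nat \<times> nat \<Rightarrow> complex. Q (i, LEAST j. Q (j, j) \<noteq> 0)) \<in> borel_measurable borel" for i
    by (rule measurable_compose_countable[where f="\<lambda>j Q. Q (i, j)"]) measurable
  then show ?thesis unfolding column_def by (intro leb_restrict_measurable)
qed

lemma tline_column_projL:
  assumes "L \<in> lines T" shows "tline T (column T (projL T L)) = L"
proof -
  obtain x where x: "nonzero_vec T x" "L = line T x"
    using assms by (auto simp: lines_iff)
  have s: "0 < sqn T x" using x by (simp add: nonzero_vec_iff)
  obtain i where i: "i < T" "x i \<noteq> 0" using x by (auto simp: nonzero_vec_def)
  define j where "j = (LEAST j. proj T x (j, j) \<noteq> 0)"
  have "proj T x (i, i) \<noteq> 0" using i s by (simp add: proj_def)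
  then have "proj T x (j, j) \<noteq> 0" unfolding j_def by (rule LeastI)
  then have j: "j < T" "x j \<noteq> 0" by (auto simp: proj_def split: if_splits)
  define c where "c = cnj (x j) / complex_of_real (sqn T x)"
  have c: "c \<noteq> 0" using j s by (simp add: c_def)
  have "column T (projL T L) = (\<lambda>i\<in>{..<T}. c * x i)"
    unfolding column_def x projL_line j_def[symmetric] using j
    by (auto simp: c_def proj_def intro!: restrict_ext)
  moreover have "nonzero_vec T (\<lambda>i\<in>{..<T}. c * x i)"
    using i c by (auto simp: nonzero_vec_def)
  ultimately show ?thesis
    using c by (simp add: tline_def nzvec_def line_scale x)
qed

text \<open>\<open>column\<close> followed by \<open>tline\<close> is a measurable left inverse of
  \<open>projL\<close>, so no information is lost by pushing a measure forward to matrices. There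
  the sigma algebra is generated by open sets.\<close>

lemma lines_measure_eqI:
  assumes T: "0 < T" and \<mu> [measurable_cong]: "sets \<mu> = sets (lines_measure T)"
    and \<nu> [measurable_cong]: "sets \<nu> = sets (lines_measure T)"
    and eq: "distr \<mu> borel (projL T) = distr \<nu> borel (projL T)"
  shows "\<mu> = \<nu>"
proof -
  have *: "distr (distr M borel (projL T)) (lines_measure T) (\<lambda>Q. tline T (column T Q)) = M"
    if M [measurable_cong]: "sets M = sets (lines_measure T)" for M
  proof -
    note tline_measurable[OF T, measurable]
    have "distr (distr M borel (projL T)) (lines_measure T) (\<lambda>Q. tline T (column T Q))
        = distr M (lines_measure T) (\<lambda>L. tline T (column T (projL T L)))"
      by (subst distr_distr) (simp_all add: comp_def)
    also have "\<dots> = distr M M (\<lambda>L. L)"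
      using sets_eq_imp_space_eq[OF M] by (intro distr_cong) (auto simp: M tline_column_projL)
    finally show ?thesis by simp
  qed
  show ?thesis using *[OF \<mu>] *[OF \<nu>] eq by metis
qed

section \<open>The distance of lines\<close>

text \<open>The square of the Hilbert-Schmidt distance of the \<open>T\<close> by \<open>T\<close>
  blocks.\<close>

definition pdist :: "nat \<Rightarrow> (nat \<times> nat \<Rightarrow> complex) \<Rightarrow> (nat \<times> nat \<Rightarrow> complex) \<Rightarrow> real" where
  "pdist T P Q = (\<Sum>i<T. \<Sum>j<T. (cmod (P (i, j) - Q (i, j)))\<^sup>2)"

lemma pdist_sym: "pdist T P Q = pdist T Q P"
  by (simp add: pdist_def norm_minus_commute)

lemma pdist_continuous: "continuous_on UNIV (pdist T P)"
  unfolding pdist_def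
  by (intro continuous_intros continuous_on_product_coordinates)

lemma pdist_measurable [measurable]:
  assumes [measurable]: "f \<in> borel_measurable M" "g \<in> borel_measurable M"
  shows "(\<lambda>x. pdist T (f x) (g x)) \<in> borel_measurable M"
proof -
  have [measurable]: "(\<lambda>Q :: nat \<times> nat \<Rightarrow> complex. Q p) \<in> borel_measurable borel" for p
    by (rule measurable_product_coordinates)
  show ?thesis unfolding pdist_def by measurable
qed

lemma cmod_proj_diff:
  assumes "p \<in> {..<T} \<times> {..<T}"
  shows "(cmod (P p - Q p))\<^sup>2 \<le> pdist T P Q"
proof -
  obtain i j where p: "p = (i, j)" "i < T" "j < T" using assms by auto
  have "(cmod (P p - Q p))\<^sup>2 \<le> (\<Sum>j<T. (cmod (P (i, j) - Q (i, j)))\<^sup>2)"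
    unfolding p(1) using p by (intro member_le_sum) auto
  also have "\<dots> \<le> pdist T P Q"
    unfolding pdist_def using p by (intro member_le_sum[where f="\<lambda>i. \<Sum>j<T. (cmod (P (i, j) - Q (i, j)))\<^sup>2"]) (auto intro: sum_nonneg)
  finally show ?thesis .
qed

text \<open>Both projections have Hilbert-Schmidt norm 1, and the trace of their product is
  \<open>|<x,y>|^2 / (|x|^2 |y|^2)\<close>. Since only inner products occur, unitary invariance
  becomes visible.\<close>

lemma pdist_proj:
  assumes "nonzero_vec T x" "nonzero_vec T y"
  shows "pdist T (proj T x) (proj T y) = 2 - 2 * (cmod (cinner T x y))\<^sup>2 / (sqn T x * sqn T y)"
proof -
  define a b where "a = complex_of_real (sqn T x)" and "b = complex_of_real (sqn T y)"
  have ab: "a \<noteq> 0" "b \<noteq> 0" using assms by (auto simp: a_def b_def nonzero_vec_iff)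
  have cab: "cnj a = a" "cnj b = b" by (simp_all add: a_def b_def)
  have S: "(\<Sum>i<T. \<Sum>j<T. (u i * cnj (u j)) * (cnj (v i) * v j)) = cinner T v u * cinner T u v" for u v
    by (simp add: cinner_def sum_product mult_ac)
  have "complex_of_real (pdist T (proj T x) (proj T y))
     = (\<Sum>i<T. \<Sum>j<T. (x i * cnj (x j) / a - y i * cnj (y j) / b) * cnj (x i * cnj (x j) / a - y i * cnj (y j) / b))"
    unfolding pdist_def of_real_sum
    by (intro sum.cong refl) (simp only: complex_norm_square, simp add: proj_def a_def b_def)
  also have "\<dots> = (\<Sum>i<T. \<Sum>j<T. (x i * cnj (x j)) * (cnj (x i) * x j) / (a * a)
       - (x i * cnj (x j)) * (cnj (y i) * y j) / (a * b) - (y i * cnj (y j)) * (cnj (x i) * x j) / (a * b)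
       + (y i * cnj (y j)) * (cnj (y i) * y j) / (b * b))"
    using ab by (intro sum.cong refl) (simp add: cab field_simps)
  also have "\<dots> = cinner T x x * cinner T x x / (a * a) - cinner T y x * cinner T x y / (a * b)
      - cinner T x y * cinner T y x / (a * b) + cinner T y y * cinner T y y / (b * b)"
    by (simp add: sum.distrib sum_subtractf S flip: sum_divide_distrib)
  also have "cinner T y x = cnj (cinner T x y)"
    by (simp add: cinner_def mult.commute)
  also have "cinner T x x * cinner T x x / (a * a) - cnj (cinner T x y) * cinner T x y / (a * b)
      - cinner T x y * cnj (cinner T x y) / (a * b) + cinner T y y * cinner T y y / (b * b)
      = 2 - 2 * (cinner T x y * cnj (cinner T x y)) / (a * b)"
    using ab by (simp add: cinner_self mult.commute flip: a_def b_def)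
  also have "\<dots> = complex_of_real (2 - 2 * (cmod (cinner T x y))\<^sup>2 / (sqn T x * sqn T y))"
    by (simp add: a_def b_def complex_norm_square del: of_real_power)
  finally show ?thesis using of_real_eq_iff by blast
qed


section \<open>Transitivity of the unitary group on lines\<close>

lemma sum_kronecker:
  fixes g :: "nat \<Rightarrow> complex"
  assumes "k < T"
  shows "(\<Sum>i<T. (if i = k then 1 else 0) * g i) = g k" "(\<Sum>i<T. (if k = i then 1 else 0) * g i) = g k"
proof -
  have "(\<Sum>i<T. (if i = k then 1 else 0) * g i) = (\<Sum>i<T. if i = k then g i else 0)"
    by (intro sum.cong refl) simp
  then show "(\<Sum>i<T. (if i = k then 1 else 0) * g i) = g k" using assms by simp
  then show "(\<Sum>i<T. (if k = i then 1 else 0) * g i) = g k" by (simp only: eq_commute[of k])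
qed

text \<open>This is the Householder reflection \<open>1 - 2 v v* / |v|^2\<close>. In its square the
  two cross terms cancel against \<open>4 v v* v v* / |v|^4\<close>.\<close>

lemma unitary_reflection:
  assumes "0 < sqn T v"
  shows "unitary T (\<lambda>i k. (if i = k then 1 else 0) - 2 * v i * cnj (v k) / complex_of_real (sqn T v))"
  unfolding unitary_def
proof (intro allI impI)
  fix k l assume kl: "k < T" "l < T"
  define N where "N = complex_of_real (sqn T v)"
  have N: "N \<noteq> 0" "cnj N = N" using assms by (simp_all add: N_def)
  define d :: "nat \<Rightarrow> nat \<Rightarrow> complex" where "d i j = (if i = j then 1 else 0)" for i j
  have cd: "cnj (d i j) = d i j" for i j by (simp add: d_def)
  have "(\<Sum>i<T. cnj (d i k - 2 * v i * cnj (v k) / N) * (d i l - 2 * v i * cnj (v l) / N))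
      = (\<Sum>i<T. d i k * d i l - d i k * (2 * v i * cnj (v l) / N) - d i l * (2 * cnj (v i) * v k / N)
          + cnj (v i) * v i * (4 * v k * cnj (v l) / (N * N)))"
    by (intro sum.cong refl) (simp add: N(2) cd algebra_simps)
  also have "\<dots> = d k l - 2 * v k * cnj (v l) / N - 2 * cnj (v l) * v k / N
      + (\<Sum>i<T. cnj (v i) * v i) * (4 * v k * cnj (v l) / (N * N))"
  proof -
    have "(\<Sum>i<T. d i k * d i l) = d k l" "(\<Sum>i<T. d i k * (2 * v i * cnj (v l) / N)) = 2 * v k * cnj (v l) / N"
      "(\<Sum>i<T. d i l * (2 * cnj (v i) * v k / N)) = 2 * cnj (v l) * v k / N"
      unfolding d_def using kl by (simp_all only: sum_kronecker)
    then show ?thesis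
      by (simp add: sum.distrib sum_subtractf sum_distrib_right sum_divide_distrib)
  qed
  also have "(\<Sum>i<T. cnj (v i) * v i) = N"
    using cinner_self[of T v] by (simp add: N_def cinner_def)
  also have "d k l - 2 * v k * cnj (v l) / N - 2 * cnj (v l) * v k / N + N * (4 * v k * cnj (v l) / (N * N)) = d k l"
    using N by (simp add: field_simps)
  finally show "(\<Sum>i<T. cnj ((if i = k then 1 else 0) - 2 * v i * cnj (v k) / complex_of_real (sqn T v)) *
      ((if i = l then 1 else 0) - 2 * v i * cnj (v l) / complex_of_real (sqn T v))) = (if k = l then 1 else 0)"
    by (simp only: N_def d_def)
qed

lemma cinner_diff_left: "cinner T (\<lambda>i. x i - y i) z = cinner T x z - cinner T y z"
  and cinner_diff_right: "cinner T z (\<lambda>i. x i - y i) = cinner T z x - cinner T z y"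
  and cinner_mult_right: "cinner T z (\<lambda>i. c * x i) = c * cinner T z x"
  and cinner_commute: "cinner T x y = cnj (cinner T y x)"
  by (simp_all add: cinner_def algebra_simps sum_subtractf sum_distrib_left)

text \<open>After a change of phase \<open>\<langle>x, c y\<rangle>\<close> is real, and the reflection in the hyperplane orthogonal to
  \<open>x - c y\<close> exchanges \<open>x\<close> and \<open>c y\<close>.\<close>

lemma unitary_transitive:
  assumes x: "nonzero_vec T x" and y: "nonzero_vec T y"
  shows "\<exists>U c. unitary T U \<and> c \<noteq> 0 \<and> mat_apply T U x = (\<lambda>i\<in>{..<T}. c * y i)"
proof -
  have sx: "0 < sqn T x" and sy: "0 < sqn T y" using x y by (simp_all add: nonzero_vec_iff)
  define a where "a = cinner T x y"
  \<comment> \<open>The phase that makes \<open>u * a\<close> real. For \<open>a = 0\<close> it is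
    set to 1, because \<open>sgn 0 = 0\<close> is not a phase.\<close>
  define u where "u = (if a = 0 then 1 else cnj (sgn a))"
  \<comment> \<open>The real factor gives \<open>c y\<close> the norm of \<open>x\<close>, as a
    reflection exchanging the two requires.\<close>
  define c where "c = complex_of_real (sqrt (sqn T x / sqn T y)) * u"
  have u: "cmod u = 1" by (simp add: u_def norm_sgn)
  have c: "c \<noteq> 0" using u sx sy by (auto simp: c_def)
  have ua: "u * a = complex_of_real (cmod a)"
  proof -
    have "a * cnj a = complex_of_real (cmod a) * complex_of_real (cmod a)"
      using complex_norm_square[of a] by (simp add: power2_eq_square)
    then have "cnj a * a / complex_of_real (cmod a) = complex_of_real (cmod a)" if "a \<noteq> 0"
      using that by (simp add: mult.commute)
    then show ?thesis by (simp add: u_def sgn_eq)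
  qed
  define y' where "y' i = c * y i" for i
  have xy': "cinner T x y' = complex_of_real (sqrt (sqn T x / sqn T y) * cmod a)"
    unfolding y'_def[abs_def] by (simp add: cinner_mult_right c_def ua mult.assoc flip: a_def)
  then have yx': "cinner T y' x = cinner T x y'"
    by (subst cinner_commute) simp
  have ny': "sqn T y' = sqn T x"
    using u sx sy by (simp add: y'_def[abs_def] sqn_scale c_def norm_mult power_mult_distrib)
  define v where "v i = x i - y' i" for i
  have vx: "cinner T v x = complex_of_real (sqn T x) - cinner T x y'"
    by (simp add: v_def[abs_def] cinner_diff_left yx' cinner_self)
  have "complex_of_real (sqn T v) = cinner T v v" by (simp add: cinner_self)
  \<comment> \<open>Equal norms and a real inner product make \<open>|v|^2\<close> twice
    \<open><v,x>\<close>; so the reflection subtracts exactly \<open>v\<close> from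
    \<open>x\<close>.\<close>
  also have "\<dots> = 2 * cinner T v x"
    by (simp add: vx) (simp add: v_def[abs_def] cinner_diff_left cinner_diff_right yx' cinner_self ny')
  finally have v2: "complex_of_real (sqn T v) = 2 * cinner T v x" .
  show ?thesis
  proof (cases "sqn T v = 0")
    case True
    then have "\<And>i. i < T \<Longrightarrow> v i = 0"
      by (auto simp: sqn_def sum_nonneg_eq_0_iff)
    then have "\<And>i. i < T \<Longrightarrow> x i = c * y i" by (simp add: v_def y'_def)
    then have "mat_apply T (\<lambda>i k. if i = k then 1 else 0) x = (\<lambda>i\<in>{..<T}. c * y i)"
      by (auto simp: mat_apply_def sum_kronecker simp del: mult_if_delta if_distribR intro!: restrict_ext)
    moreover have "unitary T (\<lambda>i k. if i = k then 1 else 0)"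
      unfolding unitary_def by (simp add: if_distrib[of cnj] sum_kronecker cong: if_cong)
    ultimately show ?thesis using c by blast
  next
    case False
    then have pos: "0 < sqn T v" using sqn_nonneg[of T v] by linarith
    let ?U = "\<lambda>i k. (if i = k then 1 else 0) - 2 * v i * cnj (v k) / complex_of_real (sqn T v)"
    have "(\<Sum>k<T. ?U i k * x k) = c * y i" if "i < T" for i
    proof -
      have "(\<Sum>k<T. ?U i k * x k) = (\<Sum>k<T. (if i = k then 1 else 0) * x k - (2 * v i / complex_of_real (sqn T v)) * (cnj (v k) * x k))"
        by (intro sum.cong refl) (simp add: algebra_simps)
      also have "\<dots> = x i - (2 * v i / complex_of_real (sqn T v)) * cinner T v x"
        using that by (simp only: sum_subtractf cinner_def sum_kronecker sum_distrib_left)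
      also have "\<dots> = x i - v i"
      proof -
        have "cinner T v x \<noteq> 0" using pos v2 by auto
        then show ?thesis by (simp add: v2)
      qed
      finally show ?thesis by (simp add: v_def y'_def)
    qed
    then have "mat_apply T ?U x = (\<lambda>i\<in>{..<T}. c * y i)"
      unfolding mat_apply_def by (intro restrict_ext) simp
    then show ?thesis using c unitary_reflection[OF pos] by blast
  qed
qed

lemma nonzero_mat_apply:
  assumes "unitary T U" shows "nonzero_vec T (mat_apply T U x) \<longleftrightarrow> nonzero_vec T x"
  by (simp add: nonzero_vec_iff sqn_mat_apply[OF assms])

lemma line_act_measurable:
  assumes T: "0 < T" and U: "unitary T U"
  shows "line_act T U \<in> measurable (lines_measure T) (lines_measure T)"
proof (rule measurable_from_lines)
  have "line_act T U (tline T x) = tline T (mat_apply T U (nzvec T x))" for x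
    using nonzero_nzvec[OF T, of x] nonzero_mat_apply[OF U, of "nzvec T x"]
    by (simp add: tline_def line_act_line) (simp add: nzvec_def)
  then show "(\<lambda>x. line_act T U (tline T x)) \<in> measurable (leb T) (lines_measure T)"
    using tline_measurable[OF T] by simp
  show "line_act T U \<in> lines T \<rightarrow> space (lines_measure T)"
  proof
    fix L assume "L \<in> lines T"
    then obtain x where "nonzero_vec T x" "L = line T x" by (auto simp: lines_iff)
    then show "line_act T U L \<in> space (lines_measure T)"
      using nonzero_mat_apply[OF U, of x] unfolding space_lines lines_iff
      by (intro exI[of _ "mat_apply T U x"]) (simp add: line_act_line, simp add: mat_apply_def)
  qed
qed

lemma pdist_line_act:
  assumes "unitary T U" "L \<in> lines T" "M \<in> lines T"
  shows "pdist T (projL T (line_act T U L)) (projL T (line_act T U M)) = pdist T (projL T L) (projL T M)"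
proof -
  obtain x y where "nonzero_vec T x" "L = line T x" "nonzero_vec T y" "M = line T y"
    using assms by (auto simp: lines_iff)
  then show ?thesis
    by (simp add: line_act_line projL_line pdist_proj nonzero_mat_apply[OF assms(1)]
        cinner_mat_apply[OF assms(1)] sqn_mat_apply[OF assms(1)])
qed

section \<open>Uniqueness of the invariant probability measure\<close>

definition invariant_prob :: "nat \<Rightarrow> (nat \<Rightarrow> complex) set measure \<Rightarrow> bool" where
  "invariant_prob T \<mu> \<longleftrightarrow> sets \<mu> = sets (lines_measure T) \<and> prob_space \<mu> \<and>
      (\<forall>U. unitary T U \<longrightarrow> line_act T U \<in> measurable \<mu> \<mu> \<and> distr \<mu> \<mu> (line_act T U) = \<mu>)"

text \<open>The radius refers to the squared distance.\<close>

definition lball :: "nat \<Rightarrow> (nat \<Rightarrow> complex) set \<Rightarrow> real \<Rightarrow> (nat \<Rightarrow> complex) set set" where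
  "lball T L e = {M \<in> lines T. pdist T (projL T L) (projL T M) < e}"

lemma invariant_prob_space:
  "invariant_prob T \<mu> \<Longrightarrow> space \<mu> = lines T"
  using sets_eq_imp_space_eq[of \<mu> "lines_measure T"] by (simp add: invariant_prob_def)

lemma lball_sets:
  assumes "sets \<mu> = sets (lines_measure T)"
  shows "lball T L e \<in> sets \<mu>"
proof -
  have "{M \<in> space (lines_measure T). pdist T (projL T L) (projL T M) < e} \<in> sets (lines_measure T)"
    by measurable
  then show ?thesis using assms by (simp add: lball_def)
qed

text \<open>Some unitary map takes \<open>L\<close> to \<open>M\<close>; it preserves
  \<open>pdist\<close>, hence pulls the ball around \<open>M\<close> back to the ball around
  \<open>L\<close>, and it preserves \<open>\<mu>\<close>.\<close>

lemma lball_homogeneous: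
  assumes \<mu>: "invariant_prob T \<mu>" and L: "L \<in> lines T" and M: "M \<in> lines T"
  shows "emeasure \<mu> (lball T M e) = emeasure \<mu> (lball T L e)"
proof -
  obtain x y where x: "nonzero_vec T x" "L = line T x" and y: "nonzero_vec T y" "M = line T y"
    using L M by (auto simp: lines_iff)
  obtain U c where U: "unitary T U" and c: "c \<noteq> 0" "mat_apply T U x = (\<lambda>i\<in>{..<T}. c * y i)"
    using unitary_transitive[OF x(1) y(1)] by blast
  have UL: "line_act T U L = M"
    using c by (simp add: x y line_act_line line_scale)
  have sets: "sets \<mu> = sets (lines_measure T)"
    and U\<mu>: "line_act T U \<in> measurable \<mu> \<mu>" "distr \<mu> \<mu> (line_act T U) = \<mu>"
    using \<mu> U by (auto simp: invariant_prob_def)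
  note sp = invariant_prob_space[OF \<mu>]
  have "emeasure \<mu> (lball T M e) = emeasure (distr \<mu> \<mu> (line_act T U)) (lball T M e)"
    by (simp add: U\<mu>)
  also have "\<dots> = emeasure \<mu> (line_act T U -` lball T M e \<inter> space \<mu>)"
    by (rule emeasure_distr[OF U\<mu>(1) lball_sets[OF sets]])
  also have "line_act T U -` lball T M e \<inter> space \<mu> = lball T L e"
    using measurable_space[OF U\<mu>(1)] pdist_line_act[OF U L]
    by (auto simp: lball_def sp UL)
  finally show ?thesis .
qed

text \<open>If one ball were null, all balls of that radius would be null by homogeneity. By the
  Lindelof property countably many of them cover the lines, so the total mass would be 0.\<close>

lemma lball_pos:
  assumes \<mu>: "invariant_prob T \<mu>" and L: "L \<in> lines T" and e: "0 < e"
  shows "0 < emeasure \<mu> (lball T L e)"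
proof (rule ccontr)
  assume "\<not> 0 < emeasure \<mu> (lball T L e)"
  then have zero: "emeasure \<mu> (lball T M e) = 0" if "M \<in> lines T" for M
    using lball_homogeneous[OF \<mu> L that] by (simp add: not_gr_zero)
  have sets: "sets \<mu> = sets (lines_measure T)" and "prob_space \<mu>"
    using \<mu> by (auto simp: invariant_prob_def)
  interpret prob_space \<mu> by fact
  \<comment> \<open>Lindelof is applied to balls in the space of matrices, as the lines have not
    been given a topology.\<close>
  define O' where "O' M = {Q. pdist T (projL T M) Q < e}" for M
  have op: "open S" if "S \<in> O' ` lines T" for S
    using that unfolding O'_def
    by (auto intro!: open_Collect_less pdist_continuous continuous_intros)
  obtain F where F: "F \<subseteq> O' ` lines T" "countable F" "\<Union>F = \<Union>(O' ` lines T)"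
    using Lindelof[OF op] by blast
  have 1: "{M \<in> lines T. projL T M \<in> S} \<in> null_sets \<mu>" if S: "S \<in> F" for S
  proof -
    obtain M where "M \<in> lines T" "S = O' M" using F S by auto
    then have "{M \<in> lines T. projL T M \<in> S} = lball T M e"
      by (auto simp: lball_def O'_def)
    then show ?thesis
      using zero[OF \<open>M \<in> lines T\<close>] lball_sets[OF sets] by auto
  qed
  have "(\<Union>S\<in>F. {M \<in> lines T. projL T M \<in> S}) \<in> null_sets \<mu>"
    by (rule null_sets_UN'[OF F(2) 1])
  moreover have "M \<in> (\<Union>S\<in>F. {M \<in> lines T. projL T M \<in> S})" if M: "M \<in> lines T" for M
  proof -
    have "projL T M \<in> O' M" using e by (simp add: O'_def pdist_def)
    then have "projL T M \<in> \<Union>F" using M F by auto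
    then show ?thesis using M by auto
  qed
  then have "(\<Union>S\<in>F. {M \<in> lines T. projL T M \<in> S}) = space \<mu>"
    by (auto simp: invariant_prob_space[OF \<mu>])
  ultimately show False using emeasure_space_1 by (auto dest: null_setsD1)
qed

text \<open>A basic neighbourhood in the product topology constrains finitely many entries. Those
  inside the \<open>T\<close> by \<open>T\<close> block are controlled by \<open>pdist\<close>;
  those outside vanish for every line.\<close>

lemma lball_subset_open:
  assumes "open G" "L \<in> lines T" "projL T L \<in> G"
  shows "\<exists>e>0. lball T L e \<subseteq> {M \<in> lines T. projL T M \<in> G}"
proof -
  let ?Q = "projL T L"
  have "openin (product_topology (\<lambda>_. euclidean) UNIV) G"
    using assms(1) by (simp add: euclidean_product_topology)
  from product_topology_open_contains_basis[OF this assms(3)]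
  obtain X where X: "?Q \<in> Pi\<^sub>E UNIV X" "\<And>p. open (X p)" "finite {p. X p \<noteq> UNIV}" "Pi\<^sub>E UNIV X \<subseteq> G"
    by auto
  have ev: "\<forall>p\<in>{p. X p \<noteq> UNIV}. eventually (\<lambda>d. ball (?Q p) d \<subseteq> X p) (at_right 0)"
  proof
    fix p
    have "?Q p \<in> X p" using X(1) by auto
    then obtain d where d: "d > 0" "ball (?Q p) d \<subseteq> X p"
      using X(2) openE by blast
    have "eventually (\<lambda>d'. d' < d) (at_right 0)"
      using d by (intro order_tendstoD(2)[OF tendsto_ident_at]) 
    then show "eventually (\<lambda>d. ball (?Q p) d \<subseteq> X p) (at_right 0)"
      by eventually_elim (use d subset_ball[of _ d "?Q p"] in force)
  qed
  have "eventually (\<lambda>d. (\<forall>p\<in>{p. X p \<noteq> UNIV}. ball (?Q p) d \<subseteq> X p) \<and> 0 < d) (at_right 0)"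
    by (intro eventually_conj eventually_ball_finite X(3) ev eventually_at_right_less)
  then obtain d :: real where d: "0 < d" "\<And>p. X p \<noteq> UNIV \<Longrightarrow> ball (?Q p) d \<subseteq> X p"
    by (auto dest!: eventually_happens)
  \<comment> \<open>\<open>pdist\<close> is a squared distance, hence the radius \<open>d^2\<close>
    for entries closer than \<open>d\<close>.\<close>
  have "projL T M \<in> G" if M: "M \<in> lball T L (d\<^sup>2)" for M
  proof -
    have "projL T M p \<in> X p" for p
    proof (cases "p \<in> {..<T} \<times> {..<T} \<and> X p \<noteq> UNIV")
      case True
      have "(cmod (?Q p - projL T M p))\<^sup>2 < d\<^sup>2"
        using cmod_proj_diff[of p T ?Q "projL T M"] M True by (auto simp: lball_def)
      then have "cmod (?Q p - projL T M p) < d" using d(1) by (simp add: power2_less_imp_less)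
      then have "projL T M p \<in> ball (?Q p) d" by (simp add: dist_norm)
      then show ?thesis using d(2) True by blast
    next
      case False
      then have "X p = UNIV \<or> projL T M p = ?Q p"
        by (cases p) (auto simp: projL_def proj_def)
      then show ?thesis using X(1) by auto
    qed
    then show ?thesis using X(4) by auto
  qed
  then show ?thesis using d(1) by (intro exI[of _ "d\<^sup>2"]) (auto simp: lball_def)
qed

lemma invariant_prob_open_le:
  assumes \<mu>: "invariant_prob T \<mu>" and \<nu>: "invariant_prob T \<nu>" and G: "open G"
  shows "emeasure \<mu> {L \<in> lines T. projL T L \<in> G} \<le> emeasure \<nu> {L \<in> lines T. projL T L \<in> G}"
proof -
  have s\<mu> [measurable_cong]: "sets \<mu> = sets (lines_measure T)" and "prob_space \<mu>"
    and s\<nu> [measurable_cong]: "sets \<nu> = sets (lines_measure T)" and "prob_space \<nu>"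
    using \<mu> \<nu> by (auto simp: invariant_prob_def)
  interpret m: prob_space \<mu> by fact
  interpret n: prob_space \<nu> by fact
  interpret P: pair_prob_space \<mu> \<nu> ..
  note sp = invariant_prob_space[OF \<mu>] invariant_prob_space[OF \<nu>]
  obtain L0 where L0: "L0 \<in> lines T" using m.not_empty sp by auto
  let ?G = "{L \<in> lines T. projL T L \<in> G}"
  let ?D = "\<lambda>L M. pdist T (projL T L) (projL T M)"
  have [measurable]: "G \<in> sets borel" using G by simp
  have "{L \<in> space (lines_measure T). projL T L \<in> G} \<in> sets (lines_measure T)"
    by measurable
  then have G_sets [measurable]: "?G \<in> sets (lines_measure T)" by simp
  define h where "h e = emeasure \<nu> (lball T L0 e)" for e
  have ind\<nu>: "(\<integral>\<^sup>+M. (if ?D L M < e then 1 else 0) \<partial>\<nu>) = h e" if "L \<in> lines T" for L e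
  proof -
    have "(\<integral>\<^sup>+M. (if ?D L M < e then 1 else 0) \<partial>\<nu>) = (\<integral>\<^sup>+M. indicator (lball T L e) M \<partial>\<nu>)"
      by (intro nn_integral_cong) (auto simp: lball_def indicator_def sp)
    then show ?thesis
      using lball_homogeneous[OF \<nu> L0 that] lball_sets[OF s\<nu>] by (simp add: h_def)
  qed
  have ind\<mu>: "(\<integral>\<^sup>+L. (if ?D L M < e then 1 else 0) \<partial>\<mu>) = emeasure \<mu> (lball T L0 e)" if "M \<in> lines T" for M e
  proof -
    have "(\<integral>\<^sup>+L. (if ?D L M < e then 1 else 0) \<partial>\<mu>) = (\<integral>\<^sup>+L. indicator (lball T M e) L \<partial>\<mu>)"
      by (intro nn_integral_cong) (auto simp: lball_def indicator_def sp pdist_sym)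
    then show ?thesis
      using lball_homogeneous[OF \<mu> L0 that] lball_sets[OF s\<mu>] by simp
  qed
  \<comment> \<open>Both sides are the mass of the pairs at distance below \<open>e\<close> under
    the product measure: each inner integral is constant by homogeneity, and the outer measure has
    total mass 1.\<close>
  have h\<mu>: "emeasure \<mu> (lball T L0 e) = h e" for e
  proof -
    have "(\<integral>\<^sup>+M. \<integral>\<^sup>+L. (if ?D L M < e then 1 else 0) \<partial>\<mu> \<partial>\<nu>) = (\<integral>\<^sup>+L. \<integral>\<^sup>+M. (if ?D L M < e then 1 else 0) \<partial>\<nu> \<partial>\<mu>)"
      by (rule P.Fubini') measurable
    moreover have "(\<integral>\<^sup>+M. \<integral>\<^sup>+L. (if ?D L M < e then 1 else 0) \<partial>\<mu> \<partial>\<nu>) = (\<integral>\<^sup>+M. emeasure \<mu> (lball T L0 e) \<partial>\<nu>)"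
      by (rule nn_integral_cong) (simp add: ind\<mu> sp)
    moreover have "(\<integral>\<^sup>+L. \<integral>\<^sup>+M. (if ?D L M < e then 1 else 0) \<partial>\<nu> \<partial>\<mu>) = (\<integral>\<^sup>+L. h e \<partial>\<mu>)"
      by (rule nn_integral_cong) (simp add: ind\<nu> sp)
    ultimately show ?thesis by (simp add: m.emeasure_space_1 n.emeasure_space_1)
  qed
  define e where "e k = 1 / real (Suc k)" for k
  have e: "0 < e k" for k by (simp add: e_def)
  have h_pos: "h (e k) \<noteq> 0" for k
    using lball_pos[OF \<nu> L0 e] unfolding h_def by (metis less_irrefl)
  have h_fin: "h (e k) \<noteq> \<infinity>" for k by (simp add: h_def)
  \<comment> \<open>For \<open>L\<close> in \<open>G\<close> this is the proportion, with respect to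
    \<open>\<nu>\<close>, of the ball around \<open>L\<close> that lies in \<open>G\<close>. It
    equals 1 as soon as the ball is contained in \<open>G\<close>, and Fatou's lemma carries this to
    the integral.\<close>
  define u where "u k L = (\<integral>\<^sup>+M. indicator ?G L * indicator ?G M * (if ?D L M < e k then 1 else 0) / h (e k) \<partial>\<nu>)" for k L
  have [measurable]: "u k \<in> borel_measurable \<mu>" for k
    unfolding u_def by measurable
  have "emeasure \<mu> ?G = (\<integral>\<^sup>+L. indicator ?G L \<partial>\<mu>)"
    by (rule nn_integral_indicator[symmetric]) (simp add: s\<mu> G_sets)
  also have "\<dots> \<le> (\<integral>\<^sup>+L. liminf (\<lambda>k. u k L) \<partial>\<mu>)"
  proof (rule nn_integral_mono)
    fix L assume "L \<in> space \<mu>"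
    show "indicator ?G L \<le> liminf (\<lambda>k. u k L)"
    proof (cases "L \<in> ?G")
      case True
      then obtain d where d: "d > 0" "lball T L d \<subseteq> ?G"
        using lball_subset_open[OF G, of L T] by auto
      have "eventually (\<lambda>k. e k < d) sequentially"
        using order_tendstoD(2)[OF LIMSEQ_inverse_real_of_nat d(1)] by (simp add: e_def inverse_eq_divide)
      then have "eventually (\<lambda>k. 1 \<le> u k L) sequentially"
      proof eventually_elim
        case (elim k)
        have "u k L = (\<integral>\<^sup>+M. (if ?D L M < e k then 1 else 0) / h (e k) \<partial>\<nu>)"
          unfolding u_def
        proof (rule nn_integral_cong)
          fix M assume "M \<in> space \<nu>"
          then have "M \<in> ?G" if "?D L M < e k"
            using that elim d(2) by (auto simp: lball_def sp)
          then show "indicator ?G L * indicator ?G M * (if ?D L M < e k then 1 else 0) / h (e k)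
            = (if ?D L M < e k then 1 else 0) / h (e k)"
            using True by (simp add: indicator_def)
        qed
        also have "\<dots> = h (e k) / h (e k)"
          using True by (subst nn_integral_divide) (auto simp: ind\<nu>)
        also have "\<dots> = 1" using h_pos h_fin by (simp add: ennreal_divide_self less_top)
        finally show ?case by simp
      qed
      then have "1 \<le> liminf (\<lambda>k. u k L)" by (rule Liminf_bounded)
      then show ?thesis using True by simp
    qed simp
  qed
  also have "\<dots> \<le> liminf (\<lambda>k. \<integral>\<^sup>+L. u k L \<partial>\<mu>)"
    by (rule nn_integral_liminf) simp
  also have "\<dots> \<le> emeasure \<nu> ?G"
  proof (rule Liminf_le)
    have "(\<integral>\<^sup>+L. u k L \<partial>\<mu>) \<le> emeasure \<nu> ?G" for k
    proof -
      \<comment> \<open>Once the indicator of \<open>L\<close> is bounded by 1 and the integrals are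
        exchanged, the inner integral over \<open>L\<close> is the \<open>\<mu>\<close>-mass of a
        ball around \<open>M\<close> divided by \<open>h (e k)\<close>. Equality of the ball masses
        makes it 1.\<close>
      have "(\<integral>\<^sup>+L. u k L \<partial>\<mu>) \<le> (\<integral>\<^sup>+L. \<integral>\<^sup>+M. indicator ?G M * ((if ?D L M < e k then 1 else 0) / h (e k)) \<partial>\<nu> \<partial>\<mu>)"
        unfolding u_def by (intro nn_integral_mono) (auto simp: indicator_def)
      also have "\<dots> = (\<integral>\<^sup>+M. \<integral>\<^sup>+L. indicator ?G M * ((if ?D L M < e k then 1 else 0) / h (e k)) \<partial>\<mu> \<partial>\<nu>)"
        by (rule P.Fubini'[symmetric]) measurable
      also have "\<dots> = (\<integral>\<^sup>+M. indicator ?G M \<partial>\<nu>)"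
      proof (rule nn_integral_cong)
        fix M assume M: "M \<in> space \<nu>"
        have "(\<integral>\<^sup>+L. indicator ?G M * ((if ?D L M < e k then 1 else 0) / h (e k)) \<partial>\<mu>)
           = indicator ?G M * (h (e k) / h (e k))"
          using M by (simp add: nn_integral_cmult nn_integral_divide ind\<mu> h\<mu> sp)
        then show "(\<integral>\<^sup>+L. indicator ?G M * ((if ?D L M < e k then 1 else 0) / h (e k)) \<partial>\<mu>) = indicator ?G M"
          using h_pos h_fin by (simp add: ennreal_divide_self less_top)
      qed
      also have "\<dots> = emeasure \<nu> ?G"
        by (rule nn_integral_indicator) (simp add: s\<nu> G_sets)
      finally show ?thesis .
    qed
    then show "eventually (\<lambda>k. (\<integral>\<^sup>+L. u k L \<partial>\<mu>) \<le> emeasure \<nu> ?G) sequentially" by simp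
  qed simp
  finally show ?thesis .
qed

text \<open>The inequality on open sets holds in both directions, and the open sets are an
  intersection-stable generator of the Borel sets of matrices.\<close>

lemma invariant_prob_unique:
  assumes T: "0 < T" and \<mu>: "invariant_prob T \<mu>" and \<nu>: "invariant_prob T \<nu>"
  shows "\<mu> = \<nu>"
proof (rule lines_measure_eqI[OF T])
  show s\<mu> [measurable_cong]: "sets \<mu> = sets (lines_measure T)"
    and s\<nu> [measurable_cong]: "sets \<nu> = sets (lines_measure T)"
    using \<mu> \<nu> by (auto simp: invariant_prob_def)
  have "prob_space \<mu>" using \<mu> by (simp add: invariant_prob_def)
  then interpret m: prob_space "distr \<mu> borel (projL T)" by (rule prob_space.prob_space_distr) simp
  have d: "emeasure (distr M borel (projL T)) G = emeasure M {L \<in> lines T. projL T L \<in> G}"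
    if M: "invariant_prob T M" and G: "open G" for M G
  proof -
    have [measurable_cong]: "sets M = sets (lines_measure T)" using M by (simp add: invariant_prob_def)
    show ?thesis
      using G by (subst emeasure_distr) (auto simp: invariant_prob_space[OF M] intro!: arg_cong[where f="emeasure M"])
  qed
  show "distr \<mu> borel (projL T) = distr \<nu> borel (projL T)"
  proof (rule measure_eqI_generator_eq[where E="{S. open S}" and \<Omega>=UNIV and A="\<lambda>_. UNIV"])
    show "Int_stable {S :: (nat \<times> nat \<Rightarrow> complex) set. open S}" by (auto simp: Int_stable_def)
    fix X :: "(nat \<times> nat \<Rightarrow> complex) set" assume "X \<in> {S. open S}"
    then have X: "open X" by simp
    show "emeasure (distr \<mu> borel (projL T)) X = emeasure (distr \<nu> borel (projL T)) X"
      unfolding d[OF \<mu> X] d[OF \<nu> X]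
      by (intro antisym invariant_prob_open_le \<mu> \<nu> X)
  next
    show "emeasure (distr \<mu> borel (projL T)) UNIV \<noteq> \<infinity>"
      using m.emeasure_finite by simp
  qed (auto simp: borel_def)
qed

section \<open>The law of the parametrization\<close>

definition gaussR :: "real measure" where
  "gaussR = density lborel (\<lambda>x. ennreal (exp (- x\<^sup>2) / sqrt pi))"

lemma sets_gaussR [simp, measurable_cong]: "sets gaussR = sets borel"
  by (simp add: gaussR_def)

lemma space_gaussR [simp]: "space gaussR = UNIV"
  by (simp add: gaussR_def)

lemma prob_space_gaussR: "prob_space gaussR"
proof
  have "emeasure gaussR UNIV = (\<integral>\<^sup>+x. ennreal (1 / sqrt pi) * ennreal (exp (- x\<^sup>2)) \<partial>lborel)"
    by (simp add: gaussR_def emeasure_density flip: ennreal_mult)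
  also have "\<dots> = 1"
    by (subst nn_integral_cmult) (simp_all add: nn_integral_gauss_real flip: ennreal_mult)
  finally show "emeasure gaussR (space gaussR) = 1" by simp
qed

interpretation gaussR: real_distribution gaussR
  by (intro real_distribution.intro prob_space_gaussR real_distribution_axioms.intro) simp

lemma Fcdf_eq: "Fcdf t = cdf gaussR t"
proof -
  have "cdf gaussR t = (\<integral>x. indicator {..t} x \<partial>gaussR)"
    by (simp add: cdf_def)
  also have "\<dots> = (\<integral>x. (exp (- x\<^sup>2) / sqrt pi) *\<^sub>R indicator {..t} x \<partial>lborel)"
    unfolding gaussR_def by (rule integral_density) auto
  also have "\<dots> = (\<integral>x. (1 / sqrt pi) * (indicator {..t} x *\<^sub>R exp (- x\<^sup>2)) \<partial>lborel)"
    by (intro Bochner_Integration.integral_cong) auto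
  also have "\<dots> = Fcdf t"
    unfolding Fcdf_def set_lebesgue_integral_def by (rule integral_mult_right_zero)
  finally show ?thesis by simp
qed

text \<open>The density is positive everywhere. Consequently intervals of positive length have
  positive mass and points have none, which makes \<open>Fcdf\<close> strictly increasing and
  continuous.\<close>

lemma gaussR_null_iff:
  assumes "A \<in> sets borel"
  shows "emeasure gaussR A = 0 \<longleftrightarrow> emeasure lborel A = 0"
proof -
  have "A \<in> null_sets gaussR \<longleftrightarrow> (AE x in lborel. x \<notin> A)"
    unfolding gaussR_def using assms by (subst null_sets_density_iff) auto
  also have "\<dots> \<longleftrightarrow> A \<in> null_sets lborel"
    using assms by (subst AE_iff_null_sets) auto
  finally show ?thesis using assms by auto
qed

lemma Fcdf_strict_mono: "s < t \<Longrightarrow> Fcdf s < Fcdf t"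
proof -
  assume st: "s < t"
  have "emeasure gaussR {s<..t} \<noteq> 0"
    using st by (subst gaussR_null_iff) auto
  then have "0 < measure gaussR {s<..t}"
    by (simp add: gaussR.emeasure_eq_measure zero_less_measure_iff)
  moreover have "measure gaussR {s<..t} = Fcdf t - Fcdf s"
    unfolding Fcdf_eq using st by (simp add: gaussR.cdf_diff_eq)
  ultimately show "Fcdf s < Fcdf t" by simp
qed

lemma Fcdf_less_iff: "Fcdf s < Fcdf t \<longleftrightarrow> s < t"
  using Fcdf_strict_mono[of s t] Fcdf_strict_mono[of t s] by (cases s t rule: linorder_cases) auto

lemma Fcdf_bounds: "0 < Fcdf t" "Fcdf t < 1"
proof -
  have "0 \<le> Fcdf (t - 1)" "Fcdf (t + 1) \<le> 1"
    by (simp_all add: Fcdf_eq gaussR.cdf_nonneg gaussR.cdf_bounded_prob)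
  then show "0 < Fcdf t" "Fcdf t < 1"
    using Fcdf_strict_mono[of "t - 1" t] Fcdf_strict_mono[of t "t + 1"] by auto
qed

lemma Fcdf_surj:
  assumes "0 < a" "a < 1" shows "\<exists>t. Fcdf t = a"
proof -
  have "eventually (\<lambda>t. cdf gaussR t < a) at_bot"
    using order_tendstoD(2)[OF gaussR.cdf_lim_at_bot] assms by simp
  then obtain s where s: "Fcdf s < a"
    by (auto simp: Fcdf_eq dest: eventually_happens)
  have "eventually (\<lambda>t. a < cdf gaussR t) at_top"
    using order_tendstoD(1)[OF gaussR.cdf_lim_at_top_prob] assms by simp
  then obtain t where t: "a < Fcdf t"
    by (auto simp: Fcdf_eq dest: eventually_happens)
  have "s \<le> t" using s t Fcdf_less_iff[of s t] by simp
  moreover have "isCont Fcdf x" for x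
  proof -
    have "emeasure gaussR {x} = 0" by (subst gaussR_null_iff) auto
    then have "isCont (cdf gaussR) x"
      by (simp add: gaussR.isCont_cdf measure_def)
    then show ?thesis using Fcdf_eq by presburger
  qed
  ultimately show ?thesis
    using IVT[of Fcdf s a t] s t by auto
qed

lemma Finv_le_iff:
  assumes "0 < a" "a < 1" shows "Finv a \<le> t \<longleftrightarrow> a \<le> Fcdf t"
proof -
  obtain s where s: "Fcdf s = a" using Fcdf_surj[OF assms] by blast
  have "s' = s" if "Fcdf s' = a" for s'
    using that s Fcdf_strict_mono[of s s'] Fcdf_strict_mono[of s' s] by (cases s s' rule: linorder_cases) auto
  then have "Finv a = s" unfolding Finv_def using s by (intro the_equality)
  then show ?thesis using Fcdf_less_iff[of t s] s by (auto simp: not_less[symmetric])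
qed

text \<open>Here the description in \<open>Finv\<close> has no solution and denotes one unspecified
  value, the same for all such \<open>a\<close>. So \<open>Finv\<close> is Borel on the whole line,
  which carries \<open>unif\<close>.\<close>

lemma Finv_outside:
  assumes "\<not> (0 < a \<and> a < 1)" shows "Finv a = (THE t. False)"
proof -
  have "(Fcdf t = a) = False" for t using Fcdf_bounds[of t] assms by auto
  then show ?thesis by (simp add: Finv_def)
qed

lemma Finv_measurable [measurable]: "Finv \<in> borel_measurable borel"
proof (rule borel_measurable_iff_le[THEN iffD2], rule allI)
  fix t
  have "{a \<in> space borel. Finv a \<le> t} = ({0<..<1} \<inter> {..Fcdf t}) \<union> (if (THE t. False) \<le> t then - {0<..<1} else {})"
  proof (rule set_eqI)
    fix a show "a \<in> {a \<in> space borel. Finv a \<le> t} \<longleftrightarrow>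
        a \<in> ({0<..<1} \<inter> {..Fcdf t}) \<union> (if (THE t. False) \<le> t then - {0<..<1} else {})"
      by (cases "0 < a \<and> a < 1") (auto simp: Finv_le_iff Finv_outside)
  qed
  then show "{a \<in> space borel. Finv a \<le> t} \<in> sets borel" by simp
qed

lemma distr_Finv: "distr unif borel Finv = gaussR"
proof (rule measure_eqI_lessThan)
  interpret U: prob_space unif by (rule prob_space_unif)
  interpret D: prob_space "distr unif borel Finv" by (rule U.prob_space_distr) simp
  fix t
  show "emeasure (distr unif borel Finv) {t<..} < \<infinity>" by (simp add: D.emeasure_eq_measure)
  have *: "{0<..<1} \<inter> Finv -` {t<..} = {Fcdf t<..<1}"
    using Finv_le_iff[of _ t] Fcdf_bounds[of t] by (force simp: not_le[symmetric])
  have "emeasure (distr unif borel Finv) {t<..} = emeasure lborel ({0<..<1} \<inter> Finv -` {t<..})"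
    using measurable_sets[OF Finv_measurable, of "{t<..}"]
    by (simp add: emeasure_distr emeasure_uniform_measure divide_ennreal_def)
  also have "\<dots> = ennreal (1 - Fcdf t)"
    unfolding * using Fcdf_bounds[of t] by simp
  also have "1 - Fcdf t = measure gaussR {t<..}"
    using gaussR.prob_compl[of "{..t}"] by (simp add: Fcdf_eq cdf_def Compl_eq_Diff_UNIV[symmetric])
  finally show "emeasure (distr unif borel Finv) {t<..} = emeasure gaussR {t<..}"
    by (simp add: gaussR.emeasure_eq_measure)
qed simp_all

section \<open>From the cube to the Gaussian vector\<close>

lemma Complex_measurable [measurable]: "(\<lambda>(x, y). Complex x y) \<in> borel_measurable (borel \<Otimes>\<^sub>M borel)"
  by (simp add: Complex_eq case_prod_beta)

lemma distr_Complex_gaussR: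
  "distr (gaussR \<Otimes>\<^sub>M gaussR) borel (\<lambda>(x, y). Complex x y) = gauss1"
proof -
  let ?f = "\<lambda>x. ennreal (exp (- x\<^sup>2) / sqrt pi)"
  have m: "(\<lambda>(x, y). Complex x y) \<in> measurable (lborel \<Otimes>\<^sub>M lborel) borel"
    by (simp add: Complex_eq case_prod_beta)
  have "gaussR \<Otimes>\<^sub>M gaussR = density (lborel \<Otimes>\<^sub>M lborel) (\<lambda>(x, y). ?f x * ?f y)"
    unfolding gaussR_def
    using prob_space_imp_sigma_finite[OF prob_space_gaussR]
    by (intro pair_measure_density) (auto simp: gaussR_def intro: sigma_finite_lborel)
  also have "\<dots> = density (lborel \<Otimes>\<^sub>M lborel) (\<lambda>p. ennreal (exp (- (cmod (case p of (x, y) \<Rightarrow> Complex x y))\<^sup>2) / pi))"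
    by (intro arg_cong[where f="density _"] ext)
       (auto simp: cmod_power2 exp_diff exp_minus field_simps simp flip: ennreal_mult)
  finally have "distr (gaussR \<Otimes>\<^sub>M gaussR) borel (\<lambda>(x, y). Complex x y)
      = density (distr (lborel \<Otimes>\<^sub>M lborel) borel (\<lambda>(x, y). Complex x y)) (\<lambda>z. ennreal (exp (- (cmod z)\<^sup>2) / pi))"
    using m by (simp add: density_distr)
  then show ?thesis by (simp add: gauss1_def flip: lborel_complex_eq)
qed

lemma measurable_unif:
  "measurable unif N = measurable borel N" "measurable M unif = measurable M borel"
  by (rule measurable_cong_sets; simp)+

lemma prob_space_cubeM: "prob_space (cubeM T)"
  unfolding cubeM_def by (intro prob_space_PiM prob_space_unif)

lemma cubeM_component [measurable]:
  "i < 2 * (T - 1) \<Longrightarrow> (\<lambda>p. p i) \<in> borel_measurable (cubeM T)"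
  using measurable_component_singleton[of i "{..<2 * (T - 1)}" "\<lambda>_. unif"]
  by (simp add: cubeM_def)

lemma distr_zvec_component:
  assumes k: "k < T - 1"
  shows "distr (cubeM T) borel (\<lambda>p. zvec T p k) = gauss1"
proof -
  interpret U: prob_space unif by (rule prob_space_unif)
  interpret PP: product_prob_space "\<lambda>_::nat. unif" "{..<2 * (T - 1)}" ..
  interpret C: prob_space "cubeM T" by (rule prob_space_cubeM)
  \<comment> \<open>The position of \<open>b_k\<close> in the cube.\<close>
  define m where "m = T - 1 + k"
  have km: "k < 2 * (T - 1)" "m < 2 * (T - 1)" "k \<noteq> m" using k by (auto simp: m_def)
  have [measurable]: "(\<lambda>p. p k) \<in> measurable (cubeM T) unif" "(\<lambda>p. p m) \<in> measurable (cubeM T) unif"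
    using cubeM_component[OF km(1)] cubeM_component[OF km(2)] by (simp_all cong: measurable_cong_sets)
  have "unif \<Otimes>\<^sub>M unif = distr (cubeM T) (unif \<Otimes>\<^sub>M unif) (\<lambda>p. (p k, p m))"
  proof (rule pair_measure_eqI)
    fix A B assume A: "A \<in> sets unif" and B: "B \<in> sets unif"
    have "emeasure (distr (cubeM T) (unif \<Otimes>\<^sub>M unif) (\<lambda>p. (p k, p m))) (A \<times> B)
        = emeasure (cubeM T) ((\<lambda>p. (p k, p m)) -` (A \<times> B) \<inter> space (cubeM T))"
      using A B by (intro emeasure_distr) auto
    also have "(\<lambda>p. (p k, p m)) -` (A \<times> B) \<inter> space (cubeM T)
       = {p \<in> space (cubeM T). \<forall>i\<in>{k, m}. p i \<in> (if i = k then A else B)}"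
      using km by auto
    also have "emeasure (cubeM T) \<dots> = (\<Prod>i\<in>{k, m}. emeasure unif (if i = k then A else B))"
      unfolding cubeM_def using km A B by (intro PP.emeasure_PiM_Collect) auto
    finally show "emeasure unif A * emeasure unif B = emeasure (distr (cubeM T) (unif \<Otimes>\<^sub>M unif) (\<lambda>p. (p k, p m))) (A \<times> B)"
      using km by simp
  qed (auto intro: prob_space_imp_sigma_finite prob_space_unif)
  then have "distr (cubeM T) (unif \<Otimes>\<^sub>M unif) (\<lambda>p. (p k, p m)) = unif \<Otimes>\<^sub>M unif" by simp
  moreover have "distr (cubeM T) borel (\<lambda>p. zvec T p k)
      = distr (distr (cubeM T) (unif \<Otimes>\<^sub>M unif) (\<lambda>p. (p k, p m))) borel (\<lambda>(a, b). Complex (Finv a) (Finv b))"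
  proof -
    have "(\<lambda>(a, b). Complex (Finv a) (Finv b)) \<in> borel_measurable (unif \<Otimes>\<^sub>M unif)"
      by (simp add: Complex_eq case_prod_beta)
    then show ?thesis
      unfolding zvec_def m_def[symmetric] by (subst distr_distr) (simp_all add: comp_def)
  qed
  ultimately have "distr (cubeM T) borel (\<lambda>p. zvec T p k) = distr (unif \<Otimes>\<^sub>M unif) borel (\<lambda>(a, b). Complex (Finv a) (Finv b))"
    by simp
  also have "\<dots> = distr (distr (unif \<Otimes>\<^sub>M unif) (borel \<Otimes>\<^sub>M borel) (\<lambda>(a, b). (Finv a, Finv b))) borel (\<lambda>(x, y). Complex x y)"
    by (subst distr_distr) (auto simp: comp_def split_beta')
  also have "distr (unif \<Otimes>\<^sub>M unif) (borel \<Otimes>\<^sub>M borel) (\<lambda>(a, b). (Finv a, Finv b)) = gaussR \<Otimes>\<^sub>M gaussR"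
    unfolding distr_Finv[symmetric]
    by (intro pair_measure_distr[symmetric])
       (auto simp: distr_Finv measurable_unif intro: prob_space_imp_sigma_finite prob_space_gaussR)
  finally show ?thesis by (simp add: distr_Complex_gaussR)
qed

text \<open>Entry \<open>k\<close> reads the cube only at positions \<open>k\<close> and
  \<open>n + k\<close>. These blocks are disjoint, so the entries are independent.\<close>

lemma distr_zvec:
  assumes T: "2 \<le> T"
  shows "distr (cubeM T) (leb (T - 1)) (\<lambda>p. \<lambda>k\<in>{..<T - 1}. zvec T p k) = gauss (T - 1)"
proof -
  define n where "n = T - 1"
  have n: "0 < n" using T by (simp add: n_def)
  interpret C: prob_space "cubeM T" by (rule prob_space_cubeM)
  let ?I = "{..<2 * (T - 1)}"
  have comp: "(\<lambda>p. p i) \<in> measurable (cubeM T) unif" if "i \<in> ?I" for i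
    using cubeM_component[of i T] that by (simp cong: measurable_cong_sets)
  have "C.indep_vars (\<lambda>_. unif) (\<lambda>i p. p i) ?I"
  proof (subst C.indep_vars_iff_distr_eq_PiM')
    have "0 \<in> ?I" using T by simp
    then show "?I \<noteq> {}" by blast
    have "distr (cubeM T) (PiM ?I (\<lambda>_. unif)) (\<lambda>x. \<lambda>i\<in>?I. x i) = distr (cubeM T) (cubeM T) (\<lambda>x. x)"
      by (intro distr_cong) (auto simp: cubeM_def space_PiM PiE_def extensional_restrict)
    also have "\<dots> = PiM ?I (\<lambda>_. unif)" by (simp add: cubeM_def)
    also have "\<dots> = PiM ?I (\<lambda>i. distr (cubeM T) unif (\<lambda>x. x i))"
      unfolding cubeM_def using distr_PiM_component[of ?I "\<lambda>_. unif"] prob_space_unif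
      by (intro PiM_cong refl) simp
    finally show "distr (cubeM T) (PiM ?I (\<lambda>_. unif)) (\<lambda>x. \<lambda>i\<in>?I. x i) = PiM ?I (\<lambda>i. distr (cubeM T) unif (\<lambda>x. x i))" .
  qed (rule comp)
  then have "C.indep_vars (\<lambda>k. PiM {k, n + k} (\<lambda>_. unif)) (\<lambda>k p. restrict (\<lambda>i. p i) {k, n + k}) {..<n}"
    by (rule C.indep_vars_restrict) (auto simp: n_def disjoint_family_on_def)
  then have "C.indep_vars (\<lambda>_. lborel) (\<lambda>k p. (\<lambda>q. Complex (Finv (q k)) (Finv (q (n + k)))) (restrict (\<lambda>i. p i) {k, n + k})) {..<n}"
  proof (rule C.indep_vars_compose2)
    fix k
    have "(\<lambda>q. q j) \<in> borel_measurable (PiM {k, n + k} (\<lambda>_. unif))" if "j \<in> {k, n + k}" for j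
      using measurable_component_singleton[OF that, of "\<lambda>_. unif"] by (simp only: measurable_unif)
    from this[of k] this[of "n + k"]
    have [measurable]: "(\<lambda>q. q k) \<in> borel_measurable (PiM {k, n + k} (\<lambda>_. unif))"
      "(\<lambda>q. q (n + k)) \<in> borel_measurable (PiM {k, n + k} (\<lambda>_. unif))"
      by blast+
    show "(\<lambda>q. Complex (Finv (q k)) (Finv (q (n + k)))) \<in> measurable (PiM {k, n + k} (\<lambda>_. unif)) lborel"
      by (simp add: Complex_eq)
  qed
  then have ind: "C.indep_vars (\<lambda>_. lborel) (\<lambda>k p. zvec T p k) {..<n}"
    by (simp add: zvec_def n_def)
  have "distr (cubeM T) (leb n) (\<lambda>p. \<lambda>k\<in>{..<n}. zvec T p k) = PiM {..<n} (\<lambda>k. distr (cubeM T) lborel (\<lambda>p. zvec T p k))"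
    using ind n by (subst C.indep_vars_iff_distr_eq_PiM'[symmetric]) (auto simp: C.indep_vars_def)
  also have "\<dots> = PiM {..<n} (\<lambda>_. gauss1)"
  proof (intro PiM_cong refl)
    fix k assume "k \<in> {..<n}"
    then have "distr (cubeM T) borel (\<lambda>p. zvec T p k) = gauss1"
      by (intro distr_zvec_component) (simp add: n_def)
    moreover have "distr (cubeM T) lborel (\<lambda>p. zvec T p k) = distr (cubeM T) borel (\<lambda>p. zvec T p k)"
      by (rule distr_cong) auto
    ultimately show "distr (cubeM T) lborel (\<lambda>p. zvec T p k) = gauss1" by simp
  qed
  also have "\<dots> = gauss n" by (rule PiM_gauss1)
  finally show ?thesis by (simp add: n_def)
qed

lemma zvec_measurable:
  assumes T: "2 \<le> T"
  shows "(\<lambda>p. \<lambda>k\<in>{..<T - 1}. zvec T p k) \<in> measurable (cubeM T) (leb (T - 1))"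
proof (rule leb_restrict_measurable)
  fix k assume "k < T - 1"
  then have [measurable]: "(\<lambda>p. p k) \<in> borel_measurable (cubeM T)" "(\<lambda>p. p (T - 1 + k)) \<in> borel_measurable (cubeM T)"
    by (simp_all add: cubeM_component)
  show "(\<lambda>p. zvec T p k) \<in> borel_measurable (cubeM T)"
    unfolding zvec_def Complex_eq by measurable
qed


section \<open>Polar coordinates on the space of lines\<close>

definition vcons :: "nat \<Rightarrow> complex \<Rightarrow> (nat \<Rightarrow> complex) \<Rightarrow> nat \<Rightarrow> complex" where
  "vcons n x z = (\<lambda>i\<in>{..<Suc n}. if i = 0 then x else z (i - 1))"

lemma sqn_vcons: "sqn (Suc n) (vcons n x z) = (cmod x)\<^sup>2 + sqn n z"
  by (simp add: sqn_def vcons_def sum.lessThan_Suc_shift del: sum.lessThan_Suc)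

lemma vcons_scale: "(\<lambda>i\<in>{..<Suc n}. c * vcons n x z i) = vcons n (c * x) (\<lambda>i. c * z i)"
  by (auto simp: vcons_def)

lemma vcons_cong: "(\<And>i. i < n \<Longrightarrow> z i = z' i) \<Longrightarrow> vcons n x z = vcons n x z'"
  unfolding vcons_def by (intro restrict_ext) auto

lemma vcons_measurable:
  assumes [measurable]: "f \<in> borel_measurable M"
    and g: "\<And>i. i < n \<Longrightarrow> (\<lambda>p. g p i) \<in> borel_measurable M"
  shows "(\<lambda>p. vcons n (f p) (g p)) \<in> measurable M (leb (Suc n))"
  unfolding vcons_def
proof (rule leb_restrict_measurable)
  fix i assume "i < Suc n"
  then show "(\<lambda>p. if i = 0 then f p else g p (i - 1)) \<in> borel_measurable M"
    using g[of "i - 1"] by (cases "i = 0") auto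
qed

lemma vcons_measurable_pair [measurable]:
  "(\<lambda>(x, z). vcons n x z) \<in> measurable (gauss1 \<Otimes>\<^sub>M gauss n) (leb (Suc n))"
  unfolding split_beta' by (rule vcons_measurable) measurable

lemma gauss_Suc:
  "distr (gauss1 \<Otimes>\<^sub>M gauss n) (leb (Suc n)) (\<lambda>(x, z). vcons n x z) = gauss (Suc n)"
proof -
  interpret g1: prob_space gauss1 by (rule prob_space_gauss1)
  interpret gn: prob_space "gauss n" by (rule prob_space_gauss)
  interpret gp: product_sigma_finite "\<lambda>_::nat. gauss1" ..
  have "distr (gauss1 \<Otimes>\<^sub>M gauss n) (leb (Suc n)) (\<lambda>(x, z). vcons n x z) = PiM {..<Suc n} (\<lambda>_. gauss1)"
  proof (rule gp.PiM_eqI)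
    fix A :: "nat \<Rightarrow> complex set" assume "\<And>i. i \<in> {..<Suc n} \<Longrightarrow> A i \<in> sets gauss1"
    then have A: "\<And>i. i < Suc n \<Longrightarrow> A i \<in> sets borel" by simp
    have "(\<lambda>(x, z). vcons n x z) -` Pi\<^sub>E {..<Suc n} A \<inter> space (gauss1 \<Otimes>\<^sub>M gauss n)
        = A 0 \<times> Pi\<^sub>E {..<n} (\<lambda>i. A (Suc i))" (is "?l = ?r")
    proof (rule set_eqI)
      fix p
      obtain x :: complex and z :: "nat \<Rightarrow> complex" where p: "p = (x, z)" by (cases p)
      have "(\<forall>i<Suc n. (if i = 0 then x else z (i - 1)) \<in> A i) \<longleftrightarrow> x \<in> A 0 \<and> (\<forall>i<n. z i \<in> A (Suc i))"
        by (auto simp: less_Suc_eq_0_disj)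
      then show "p \<in> ?l \<longleftrightarrow> p \<in> ?r"
        by (auto simp: p vcons_def space_pair_measure space_leb PiE_def Pi_def)
    qed
    moreover have "Pi\<^sub>E {..<Suc n} A \<in> sets (leb (Suc n))"
      using A by (intro sets_PiM_I_finite) auto
    ultimately have "emeasure (distr (gauss1 \<Otimes>\<^sub>M gauss n) (leb (Suc n)) (\<lambda>(x, z). vcons n x z)) (Pi\<^sub>E {..<Suc n} A)
        = emeasure (gauss1 \<Otimes>\<^sub>M gauss n) (A 0 \<times> Pi\<^sub>E {..<n} (\<lambda>i. A (Suc i)))"
      by (subst emeasure_distr) auto
    also have "\<dots> = emeasure gauss1 (A 0) * emeasure (gauss n) (Pi\<^sub>E {..<n} (\<lambda>i. A (Suc i)))"
      using A by (intro gn.emeasure_pair_measure_Times) (auto intro!: sets_PiM_I_finite)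
    also have "emeasure (gauss n) (Pi\<^sub>E {..<n} (\<lambda>i. A (Suc i))) = (\<Prod>i<n. emeasure gauss1 (A (Suc i)))"
      unfolding PiM_gauss1[symmetric] using A by (intro gp.emeasure_PiM) auto
    finally show "emeasure (distr (gauss1 \<Otimes>\<^sub>M gauss n) (leb (Suc n)) (\<lambda>(x, z). vcons n x z)) (Pi\<^sub>E {..<Suc n} A)
        = (\<Prod>i<Suc n. emeasure gauss1 (A i))"
      by (simp add: prod.lessThan_Suc_shift del: prod.lessThan_Suc)
  qed (simp_all cong: sets_PiM_cong)
  then show ?thesis by (simp add: PiM_gauss1)
qed

lemma tline_scale:
  assumes c: "c \<noteq> 0" shows "tline T (\<lambda>i\<in>{..<T}. c * x i) = tline T x"
proof -
  have "nonzero_vec T (\<lambda>i\<in>{..<T}. c * x i) \<longleftrightarrow> nonzero_vec T x"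
    using c by (auto simp: nonzero_vec_def)
  then show ?thesis using c by (auto simp: tline_def nzvec_def line_scale)
qed

text \<open>The line with polar coordinates \<open>(\<theta>, r)\<close>: here \<open>\<theta>\<close> is the direction of the last \<open>n\<close> coordinates
  \<open>w\<close> of its unit representative with nonnegative first coordinate, and \<open>r = |w|\<^sup>2\<^sup>n\<close>.\<close>

definition polar_line :: "nat \<Rightarrow> (nat \<Rightarrow> complex) \<times> real \<Rightarrow> (nat \<Rightarrow> complex) set" where
  "polar_line n = (\<lambda>(\<theta>, r). tline (Suc n) (vcons n (complex_of_real (sqrt (1 - r powr (1 / real n))))
      (\<lambda>i. complex_of_real (r powr (1 / (2 * real n))) * \<theta> i)))"

lemma polar_line_measurable: "polar_line n \<in> measurable (leb n \<Otimes>\<^sub>M borel) (lines_measure (Suc n))"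
proof -
  have "(\<lambda>p. vcons n (complex_of_real (sqrt (1 - snd p powr (1 / real n))))
      (\<lambda>i. complex_of_real (snd p powr (1 / (2 * real n))) * fst p i)) \<in> measurable (leb n \<Otimes>\<^sub>M borel) (leb (Suc n))"
    by (rule vcons_measurable) measurable
  then show ?thesis
    unfolding polar_line_def split_beta' by (rule measurable_compose) (simp add: tline_measurable)
qed

lemma powr_half_root:
  assumes "0 \<le> x" "0 < n"
  shows "(x powr (1 / (2 * real n)))\<^sup>2 = x powr (1 / real n)"
  using assms by (simp add: powr_powr power2_eq_square flip: powr_add)

text \<open>With \<open>N = |z|^2 + |x|^2\<close>, the \<open>n\<close>-th root of the ratio is
  \<open>|z|^2 / N\<close>. So the representative in \<open>polar_line\<close> is
  \<open>(|x|, z)\<close> divided by \<open>sqrt N\<close>, and the factor drops out of the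
  line.\<close>

lemma polar_line_ratio:
  assumes n: "0 < n"
  shows "polar_line n (dir n z, (sqn n z / (sqn n z + (cmod x)\<^sup>2)) ^ n)
    = tline (Suc n) (vcons n (complex_of_real (cmod x)) z)"
proof -
  define s N r where "s = sqn n z" and "N = s + (cmod x)\<^sup>2" and "r = (s / N) ^ n"
  have s: "0 \<le> s" by (simp add: s_def)
  have N: "0 \<le> N" "s \<le> N" using s by (simp_all add: N_def)
  have r: "r powr (1 / real n) = s / N"
  proof (cases "s / N = 0")
    case True
    show ?thesis unfolding r_def True using n by (simp add: power_0_left)
  next
    case False
    then have "0 < s / N" using s N by (simp add: less_le)
    then have "r = (s / N) powr real n" by (simp add: r_def powr_realpow)
    then show ?thesis using n \<open>0 < s / N\<close> s N by (simp add: powr_powr)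
  qed
  have "0 \<le> r" using s N by (simp add: r_def)
  then have "(r powr (1 / (2 * real n)))\<^sup>2 = s / N" using powr_half_root[OF _ n] r by simp
  then have r2: "r powr (1 / (2 * real n)) = sqrt (s / N)"
    by (metis powr_ge_zero real_sqrt_unique)
  have zs: "z i = 0" if "s = 0" "i < n" for i
    using that by (auto simp: s_def sqn_def sum_nonneg_eq_0_iff)
  show ?thesis
  proof (cases "N = 0")
    \<comment> \<open>At the origin the left side is the line of \<open>(1, 0, ..., 0)\<close>. The
      default line of \<open>tline\<close> is that of \<open>unitvec\<close>, which makes the
      identity hold here as well.\<close>
    case True
    then have s0: "s = 0" and x: "x = 0" using s N by (auto simp: N_def add_nonneg_eq_0_iff)
    have "vcons n 0 z = vcons n 0 (\<lambda>_. 0)" using zs[OF s0] by (intro vcons_cong)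
    then have "\<not> nonzero_vec (Suc n) (vcons n 0 z)" by (auto simp: nonzero_vec_def vcons_def)
    moreover have "vcons n 1 (\<lambda>i. 0) = unitvec (Suc n)" by (simp add: vcons_def unitvec_def cong: if_cong)
    moreover have "nonzero_vec (Suc n) (unitvec (Suc n))" by (auto simp: nonzero_vec_def unitvec_def)
    ultimately show ?thesis
      using True s0 x n by (simp add: polar_line_def tline_def nzvec_def power_0_left flip: s_def N_def)
  next
    case False
    then have Np: "0 < N" using N by simp
    have "1 - s / N = (cmod x)\<^sup>2 / N" using Np by (simp add: N_def field_simps)
    then have v0: "sqrt (1 - s / N) = 1 / sqrt N * cmod x"
      by (simp add: real_sqrt_divide)
    have "sqrt (s / N) * (1 / sqrt s) = 1 / sqrt N" if "s \<noteq> 0"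
      using that s by (simp add: real_sqrt_divide)
    then have vi: "complex_of_real (sqrt (s / N)) * dir n z i = complex_of_real (1 / sqrt N) * z i" if "i < n" for i
      using that zs[OF _ that] by (cases "s = 0") (simp_all add: dir_def real_sqrt_divide flip: s_def)
    have "polar_line n (dir n z, r) = tline (Suc n) (vcons n (complex_of_real (1 / sqrt N * cmod x))
        (\<lambda>i. complex_of_real (1 / sqrt N) * z i))"
      unfolding polar_line_def prod.case r r2 v0 using vi by (intro arg_cong[where f="tline _"] vcons_cong)
    also have "\<dots> = tline (Suc n) (\<lambda>i\<in>{..<Suc n}. complex_of_real (1 / sqrt N) * vcons n (complex_of_real (cmod x)) z i)"
      unfolding vcons_scale by simp
    also have "\<dots> = tline (Suc n) (vcons n (complex_of_real (cmod x)) z)"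
      using Np by (intro tline_scale) simp
    finally show ?thesis by (simp only: r_def N_def s_def)
  qed
qed

text \<open>With \<open>r = gammaP n (|z|^2)\<close> the factor \<open>fT n |z|\<close> is
  \<open>r powr (1 / (2 n))\<close> divided by \<open>|z|\<close>. Hence \<open>w\<close> has the
  direction of \<open>z\<close>, and its squared norm is the \<open>n\<close>-th root of
  \<open>r\<close>.\<close>

lemma polar_line_theta:
  assumes T: "T = Suc n" and n: "0 < n"
  shows "theta T p = polar_line n (dir n (\<lambda>k\<in>{..<n}. zvec T p k), gammaP n (sqn n (\<lambda>k\<in>{..<n}. zvec T p k)))"
proof -
  have Tn: "T - 1 = n" using T by simp
  define z where "z = zvec T p"
  define r where "r = gammaP n (sqn n z)"
  have r: "0 \<le> r" unfolding r_def using n by (intro gammaP_nonneg) auto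
  have cn: "cnorm n w = sqrt (sqn n w)" for w by (simp add: cnorm_def sqn_def)
  have f: "fT n (cnorm n z) = 1 / sqrt (sqn n z) * r powr (1 / (2 * real n))"
    unfolding fT_def cn r_def gammaP_def by (simp add: power_mult)
  define w where "w = wvec T p"
  \<comment> \<open>For \<open>z = 0\<close> the prescribed value of \<open>wvec\<close> and the
    direction are both 0.\<close>
  have w: "w k = complex_of_real (r powr (1 / (2 * real n))) * dir n z k" if "k < n" for k
    unfolding w_def wvec_def z_def[symmetric] Tn using that f by (simp add: cn dir_def)
  have r0: "r = 0" if "sqn n z = 0"
    using gammaP_0[OF n] that by (simp add: r_def)
  have "sqn n (dir n z) = (cmod (complex_of_real (1 / sqrt (sqn n z))))\<^sup>2 * sqn n z"
    unfolding dir_def sqn_restrict by (rule sqn_scale)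
  then have "sqn n (dir n z) = (if sqn n z = 0 then 0 else 1)"
    by (simp add: power_divide norm_divide)
  moreover have "sqn n w = sqn n (\<lambda>k. complex_of_real (r powr (1 / (2 * real n))) * dir n z k)"
    unfolding sqn_def using w by (intro sum.cong) auto
  ultimately have sw: "sqn n w = r powr (1 / real n)"
    using r0 powr_half_root[OF r n] by (simp add: sqn_scale)
  define v where "v = vcons n (complex_of_real (sqrt (1 - r powr (1 / real n)))) w"
  have "theta T p = line T v"
  proof -
    have "(cnorm n w)\<^sup>2 = r powr (1 / real n)" using sw by (simp add: cn)
    then show ?thesis
      unfolding theta_def w_def[symmetric] Tn by (simp only: v_def vcons_def T)
  qed
  \<comment> \<open>The representative is nonzero: its first entry is 1 if \<open>w\<close>
    vanishes, and otherwise \<open>w\<close> itself contributes. So the default of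
    \<open>tline\<close> is not taken.\<close>
  also have "\<dots> = tline T v"
  proof -
    have "sqn (Suc n) v = (sqrt (1 - sqn n w))\<^sup>2 + sqn n w"
      unfolding v_def sqn_vcons sw by simp
    moreover have "0 < \<dots>"
    proof (cases "sqn n w = 0")
      case False
      then have "0 < sqn n w" using sqn_nonneg[of n w] by linarith
      then show ?thesis by (rule add_nonneg_pos[OF zero_le_power2])
    qed simp
    ultimately show ?thesis by (simp add: tline_def nzvec_def nonzero_vec_iff T)
  qed
  also have "v = vcons n (complex_of_real (sqrt (1 - r powr (1 / real n))))
      (\<lambda>k. complex_of_real (r powr (1 / (2 * real n))) * dir n z k)"
    unfolding v_def using w by (intro vcons_cong)
  also have "tline T \<dots> = polar_line n (dir n z, r)"
    by (simp add: polar_line_def T)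
  also have "dir n z = dir n (\<lambda>k\<in>{..<n}. z k)" by (auto simp: dir_def)
  finally show ?thesis by (simp add: z_def r_def)
qed


section \<open>The law of the Gaussian line\<close>

lemma gauss_phase:
  assumes u: "cmod u = 1" and [measurable]: "f \<in> borel_measurable (leb n)"
  shows "(\<integral>\<^sup>+z. f (\<lambda>i\<in>{..<n}. u * z i) \<partial>gauss n) = (\<integral>\<^sup>+z. f z \<partial>gauss n)"
proof -
  let ?U = "\<lambda>i k. if i = k then u else 0"
  have uu: "cnj u * u = 1" using u complex_norm_square[of u] by (simp add: mult.commute)
  have "(\<Sum>i<n. cnj (?U i k) * ?U i l) = (if k = l then 1 else 0)" if "k < n" "l < n" for k l
  proof -
    have "(\<Sum>i<n. cnj (?U i k) * ?U i l) = (\<Sum>i<n. (if i = k then 1 else 0) * (if i = l then 1 else 0))"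
      using uu by (intro sum.cong refl) auto
    then show ?thesis using that by (simp only: sum_kronecker)
  qed
  then have "unitary n ?U" by (simp add: unitary_def)
  moreover have "mat_apply n ?U z = (\<lambda>i\<in>{..<n}. u * z i)" for z
  proof -
    have "(\<Sum>k<n. ?U i k * z k) = (\<Sum>k<n. (if i = k then 1 else 0) * (u * z k))" for i
      by (intro sum.cong refl) auto
    then show ?thesis
      unfolding mat_apply_def by (intro restrict_ext) (simp only: sum_kronecker lessThan_iff)
  qed
  ultimately show ?thesis using gauss_unitary[of n ?U f] by simp
qed

text \<open>A phase can be moved from the first coordinate to the others, whose law absorbs it.\<close>

lemma distr_tline_gauss:
  "distr (gauss (Suc n)) (lines_measure (Suc n)) (tline (Suc n))
    = distr (gauss1 \<Otimes>\<^sub>M gauss n) (lines_measure (Suc n)) (\<lambda>(x, z). tline (Suc n) (vcons n (complex_of_real (cmod x)) z))"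
proof -
  interpret g1: prob_space gauss1 by (rule prob_space_gauss1)
  interpret gn: prob_space "gauss n" by (rule prob_space_gauss)
  interpret P: pair_prob_space gauss1 "gauss n" ..
  note tline_measurable[of "Suc n", simplified, measurable]
  let ?L = "lines_measure (Suc n)"
  have [measurable]: "(\<lambda>(x, z). vcons n (complex_of_real (cmod x)) z) \<in> measurable (gauss1 \<Otimes>\<^sub>M gauss n) (leb (Suc n))"
    unfolding split_beta' by (rule vcons_measurable) measurable
  have vx [measurable]: "vcons n x \<in> measurable (leb n) (leb (Suc n))" for x
    by (rule vcons_measurable) measurable
  have m1: "(\<lambda>(x, z). tline (Suc n) (vcons n x z)) \<in> measurable (gauss1 \<Otimes>\<^sub>M gauss n) ?L"
    using measurable_compose[OF vcons_measurable_pair[of n] tline_measurable[of "Suc n"]] by (simp add: split_beta')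
  have m2: "(\<lambda>(x, z). tline (Suc n) (vcons n (complex_of_real (cmod x)) z)) \<in> measurable (gauss1 \<Otimes>\<^sub>M gauss n) ?L"
  proof -
    have "(\<lambda>p. tline (Suc n) ((\<lambda>(x, z). vcons n (complex_of_real (cmod x)) z) p)) \<in> measurable (gauss1 \<Otimes>\<^sub>M gauss n) ?L"
      by measurable
    then show ?thesis by (simp add: split_beta')
  qed
  have "distr (gauss1 \<Otimes>\<^sub>M gauss n) ?L (\<lambda>(x, z). tline (Suc n) (vcons n x z))
    = distr (gauss1 \<Otimes>\<^sub>M gauss n) ?L (\<lambda>(x, z). tline (Suc n) (vcons n (complex_of_real (cmod x)) z))" (is "distr _ _ ?f = distr _ _ ?g")
  proof (rule measure_eqI)
    fix S assume "S \<in> sets (distr (gauss1 \<Otimes>\<^sub>M gauss n) ?L ?f)"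
    then have [measurable]: "S \<in> sets ?L" by simp
    define H where "H = (\<lambda>v. indicator S (tline (Suc n) v) :: ennreal)"
    have [measurable]: "H \<in> borel_measurable (leb (Suc n))" unfolding H_def by measurable
    have eq: "emeasure (distr (gauss1 \<Otimes>\<^sub>M gauss n) ?L h) S = (\<integral>\<^sup>+x. \<integral>\<^sup>+z. indicator S (h (x, z)) \<partial>gauss n \<partial>gauss1)"
      if h: "h \<in> measurable (gauss1 \<Otimes>\<^sub>M gauss n) ?L" for h
    proof -
      have "emeasure (distr (gauss1 \<Otimes>\<^sub>M gauss n) ?L h) S = (\<integral>\<^sup>+L. indicator S L \<partial>distr (gauss1 \<Otimes>\<^sub>M gauss n) ?L h)"
        by simp
      also have "\<dots> = (\<integral>\<^sup>+p. indicator S (h p) \<partial>(gauss1 \<Otimes>\<^sub>M gauss n))"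
        using h by (subst nn_integral_distr) auto
      also have "\<dots> = (\<integral>\<^sup>+x. \<integral>\<^sup>+z. indicator S (h (x, z)) \<partial>gauss n \<partial>gauss1)"
        using h by (subst gn.nn_integral_fst[symmetric]) auto
      finally show ?thesis .
    qed
    have "(\<integral>\<^sup>+z. H (vcons n x z) \<partial>gauss n) = (\<integral>\<^sup>+z. H (vcons n (complex_of_real (cmod x)) z) \<partial>gauss n)" for x
    proof (cases "x = 0")
      case False
      \<comment> \<open>Rotating \<open>z\<close> by the phase of \<open>x\<close> preserves
        \<open>gauss n\<close>; after that \<open>u\<close> is a common factor of all coordinates
        and the line ignores it.\<close>
      define u where "u = sgn x"
      have u: "cmod u = 1" "u \<noteq> 0" using False by (simp_all add: u_def norm_sgn sgn_zero_iff)
      have x: "x = u * complex_of_real (cmod x)" unfolding u_def sgn_eq using False by simp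
      have "(\<integral>\<^sup>+z. H (vcons n x z) \<partial>gauss n) = (\<integral>\<^sup>+z. H (vcons n x (\<lambda>i\<in>{..<n}. u * z i)) \<partial>gauss n)"
        by (rule gauss_phase[OF u(1), symmetric]) measurable
      also have "\<dots> = (\<integral>\<^sup>+z. H (vcons n (complex_of_real (cmod x)) z) \<partial>gauss n)"
      proof (rule nn_integral_cong)
        fix z
        have "vcons n x (\<lambda>i\<in>{..<n}. u * z i) = vcons n (u * complex_of_real (cmod x)) (\<lambda>i. u * z i)"
          by (subst x) (auto intro: vcons_cong)
        also have "\<dots> = (\<lambda>i\<in>{..<Suc n}. u * vcons n (complex_of_real (cmod x)) z i)"
          by (rule vcons_scale[symmetric])
        finally show "H (vcons n x (\<lambda>i\<in>{..<n}. u * z i)) = H (vcons n (complex_of_real (cmod x)) z)"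
          using tline_scale[OF u(2)] by (simp add: H_def)
      qed
      finally show ?thesis .
    qed simp
    then show "emeasure (distr (gauss1 \<Otimes>\<^sub>M gauss n) ?L ?f) S = emeasure (distr (gauss1 \<Otimes>\<^sub>M gauss n) ?L ?g) S"
      unfolding eq[OF m1] eq[OF m2] by (simp add: H_def)
  qed simp
  moreover have "distr (gauss (Suc n)) ?L (tline (Suc n)) = distr (gauss1 \<Otimes>\<^sub>M gauss n) ?L (\<lambda>(x, z). tline (Suc n) (vcons n x z))"
    unfolding gauss_Suc[symmetric] by (subst distr_distr) (auto simp: comp_def split_beta')
  ultimately show ?thesis by simp
qed

text \<open>Both laws are the image of \<open>dirlaw n \<Otimes>\<^sub>M unif\<close> under
  \<open>polar_line n\<close>.\<close>

lemma distr_theta_eq_gauss: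
  assumes T: "2 \<le> T"
  shows "theta T \<in> measurable (cubeM T) (lines_measure T)"
    and "distr (cubeM T) (lines_measure T) (theta T) = distr (gauss T) (lines_measure T) (tline T)"
proof -
  define n where "n = T - 1"
  have n: "0 < n" and Tn: "T = Suc n" using T by (simp_all add: n_def)
  let ?z = "\<lambda>p. \<lambda>k\<in>{..<n}. zvec T p k"
  let ?pol = "\<lambda>z. (dir n z, gammaP n (sqn n z))"
  let ?rat = "\<lambda>(x, z). (dir n z, (sqn n z / (sqn n z + (cmod x)\<^sup>2)) ^ n)"
  have z: "?z \<in> measurable (cubeM T) (leb n)" "distr (cubeM T) (leb n) ?z = gauss n"
    using zvec_measurable[OF T] distr_zvec[OF T] by (simp_all add: n_def)
  have pol: "?pol \<in> measurable (leb n) (leb n \<Otimes>\<^sub>M borel)"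
    unfolding gammaP_def by measurable
  have rat: "?rat \<in> measurable (gauss1 \<Otimes>\<^sub>M gauss n) (leb n \<Otimes>\<^sub>M borel)"
    by measurable
  have PL: "polar_line n \<in> measurable (leb n \<Otimes>\<^sub>M borel) (lines_measure T)"
    using polar_line_measurable[of n] by (simp add: Tn)
  have th: "theta T = (\<lambda>p. polar_line n (?pol (?z p)))"
    using polar_line_theta[OF Tn n] by auto
  show "theta T \<in> measurable (cubeM T) (lines_measure T)"
    unfolding th by (rule measurable_compose[OF measurable_compose[OF z(1) pol] PL])
  have "distr (cubeM T) (lines_measure T) (theta T)
      = distr (distr (distr (cubeM T) (leb n) ?z) (leb n \<Otimes>\<^sub>M borel) ?pol) (lines_measure T) (polar_line n)"
    unfolding th using z(1) pol PL measurable_compose[OF z(1) pol]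
    by (simp add: distr_distr comp_def)
  also have "\<dots> = distr (dirlaw n \<Otimes>\<^sub>M unif) (lines_measure T) (polar_line n)"
    unfolding z(2) gauss_polar[OF n] by simp
  also have "\<dots> = distr (distr (gauss1 \<Otimes>\<^sub>M gauss n) (leb n \<Otimes>\<^sub>M borel) ?rat) (lines_measure T) (polar_line n)"
    unfolding gauss_polar_ratio[OF n] by simp
  also have "\<dots> = distr (gauss1 \<Otimes>\<^sub>M gauss n) (lines_measure T) (\<lambda>(x, z). tline T (vcons n (complex_of_real (cmod x)) z))"
    using rat PL polar_line_ratio[OF n] by (simp add: distr_distr comp_def split_beta' Tn)
  also have "\<dots> = distr (gauss T) (lines_measure T) (tline T)"
    unfolding Tn by (rule distr_tline_gauss[symmetric])
  finally show "distr (cubeM T) (lines_measure T) (theta T) = distr (gauss T) (lines_measure T) (tline T)" .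
qed

text \<open>A unitary map may move the default line that \<open>tline\<close> assigns to the zero
  vector, so \<open>tline\<close> is compatible with the action only almost everywhere.\<close>

lemma AE_gauss_nonzero:
  assumes "0 < T" shows "AE x in gauss T. nonzero_vec T x"
proof -
  have "AE x in leb T. nonzero_vec T x"
  proof (rule AE_I)
    show "{x \<in> space (leb T). \<not> nonzero_vec T x} \<subseteq> Pi\<^sub>E {..<T} (\<lambda>_. {0})"
    proof
      fix x assume "x \<in> {x \<in> space (leb T). \<not> nonzero_vec T x}"
      then show "x \<in> Pi\<^sub>E {..<T} (\<lambda>_. {0})"
        by (intro PiE_I) (auto simp: nonzero_vec_def space_leb extensional_def)
    qed
    have "emeasure (leb T) (Pi\<^sub>E {..<T} (\<lambda>_. {0})) = (\<Prod>i<T. emeasure lborel {0 :: complex})"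
      by (rule lebp.emeasure_PiM) auto
    then show "emeasure (leb T) (Pi\<^sub>E {..<T} (\<lambda>_. {0})) = 0"
      using assms by simp
    show "Pi\<^sub>E {..<T} (\<lambda>_. {0}) \<in> sets (leb T)"
      by (intro sets_PiM_I_finite) auto
  qed
  then show ?thesis unfolding gauss_def by (subst AE_density) auto
qed

lemma invariant_prob_gauss:
  assumes T: "0 < T"
  shows "invariant_prob T (distr (gauss T) (lines_measure T) (tline T))" (is "invariant_prob T ?\<mu>")
  unfolding invariant_prob_def
proof (intro conjI allI impI)
  note tline_measurable[OF T, measurable]
  show "sets ?\<mu> = sets (lines_measure T)" by simp
  show "prob_space ?\<mu>"
    by (intro prob_space.prob_space_distr prob_space_gauss) measurable
  fix U assume U: "unitary T U"
  note line_act_measurable[OF T U, measurable]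
  show "line_act T U \<in> measurable ?\<mu> ?\<mu>" by simp
  have U_inv: "distr (gauss T) (leb T) (mat_apply T U) = gauss T"
  proof (rule measure_eqI)
    fix A assume "A \<in> sets (distr (gauss T) (leb T) (mat_apply T U))"
    then have [measurable]: "A \<in> sets (leb T)" by simp
    have "emeasure (distr (gauss T) (leb T) (mat_apply T U)) A = (\<integral>\<^sup>+x. indicator A x \<partial>distr (gauss T) (leb T) (mat_apply T U))"
      by simp
    also have "\<dots> = (\<integral>\<^sup>+x. indicator A (mat_apply T U x) \<partial>gauss T)"
      by (rule nn_integral_distr) auto
    also have "\<dots> = (\<integral>\<^sup>+x. indicator A x \<partial>gauss T)"
      by (rule gauss_unitary[OF U]) simp
    finally show "emeasure (distr (gauss T) (leb T) (mat_apply T U)) A = emeasure (gauss T) A" by simp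
  qed simp
  have "distr ?\<mu> ?\<mu> (line_act T U) = distr ?\<mu> (lines_measure T) (line_act T U)"
    by (intro distr_cong) auto
  also have "\<dots> = distr (gauss T) (lines_measure T) (\<lambda>x. line_act T U (tline T x))"
    by (subst distr_distr) (auto simp: comp_def)
  also have "\<dots> = distr (gauss T) (lines_measure T) (\<lambda>x. tline T (mat_apply T U x))"
  proof (rule distr_cong_AE)
    show "AE x in gauss T. line_act T U (tline T x) = tline T (mat_apply T U x)"
      using AE_gauss_nonzero[OF T]
      by eventually_elim (simp add: tline_def nzvec_def line_act_line nonzero_mat_apply[OF U])
  qed auto
  also have "\<dots> = distr (distr (gauss T) (leb T) (mat_apply T U)) (lines_measure T) (tline T)"
    by (subst distr_distr) (auto simp: comp_def)
  finally show "distr ?\<mu> ?\<mu> (line_act T U) = ?\<mu>" by (simp only: U_inv)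
qed

lemma uniform_lines_eqI:
  assumes "0 < T" "invariant_prob T \<mu>" shows "uniform_lines T = \<mu>"
  unfolding uniform_lines_def invariant_prob_def[symmetric]
  using assms invariant_prob_unique by (intro the_equality) auto

theorem theorem1:
  fixes T :: nat
  assumes "T \<ge> 2"
  shows "theta T \<in> measurable (cubeM T) (lines_measure T) \<and>
         distr (cubeM T) (lines_measure T) (theta T) = uniform_lines T"
  using assms distr_theta_eq_gauss[OF assms] uniform_lines_eqI[OF _ invariant_prob_gauss, of T]
  by simp

end
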